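(* Let $\mathbb{K}$ be an algebraically closed field of characteristic zero, let $t\ge 1$ and $k\ge 2$ be integers, put $d=tk(k-1)$, let $e\in\mathbb{K}$ be a primitive $d$-th root of unity, and let $G=\langle\operatorname{diag}(1,e,e^{k})\rangle\subset\mathrm{GL}(3,\mathbb{K})$. Then the ideal $\mathrm{I}(X_{2,d}^G)$ has a quadratic Gröbner basis.
   Context: A diagonal matrix $\operatorname{diag}(g_0,g_1,g_2)$ acts on $\mathbb{K}[x_0,x_1,x_2]$ by $x_i\mapsto g_ix_i$. Let $\mathcal{B}_1=\{m_1,\dots,m_\mu\}$ be the set of $G$-invariant monomials of degree $d$ in $\mathbb{K}[x_0,x_1,x_2]$. $X_{2,d}^G$ is the projective toric variety parameterized by $\mathcal{B}_1$; its homogeneous ideal $\mathrm{I}(X_{2,d}^G)$ is the kernel of $S=\mathbb{K}[w_1,\dots,w_\mu]\to\mathbb{K}[x_0,x_1,x_2]$, $w_i\mapsto m_i$. A homogeneous ideal of $S$ has a quadratic Gröbner basis if it has a Gröbner basis consisting of polynomials of degree 2 with respect to some coordinate system of $S$ and some term order (equivalently, the quotient algebra is G-quadratic). *)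

theory Defs
  imports
    "HOL-Analysis.Analysis"
    "HOL-Library.Poly_Mapping"
    "HOL-Computational_Algebra.Polynomial"
    "HOL-Algebra.Generated_Groups"
    "HOL-Algebra.QuotRing"
begin

text \<open>
  Polynomials in variables indexed by \<^typ>\<open>'v\<close> are finitely supported maps from exponent vectors
  to coefficients, with the convolution product provided by the type-class instances of
  \<^theory>\<open>HOL-Library.Poly_Mapping\<close>.
\<close>

type_synonym 'v expo = "'v \<Rightarrow>\<^sub>0 nat"
type_synonym ('v, 'k) mpol = "'v expo \<Rightarrow>\<^sub>0 'k"

definition pconst :: "'k \<Rightarrow> ('v, 'k::zero) mpol" where
  "pconst c = Poly_Mapping.single 0 c"

definition pmonom :: "'v expo \<Rightarrow> ('v, 'k::zero_neq_one) mpol" where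
  "pmonom a = Poly_Mapping.single a 1"

definition pvar :: "'v \<Rightarrow> ('v, 'k::zero_neq_one) mpol" where
  "pvar v = pmonom (Poly_Mapping.single v 1)"

definition expo_deg :: "'v expo \<Rightarrow> nat" where
  "expo_deg a = (\<Sum>v\<in>Poly_Mapping.keys a. Poly_Mapping.lookup a v)"

definition expos_in :: "'v set \<Rightarrow> 'v expo set" where
  "expos_in V = {a. Poly_Mapping.keys a \<subseteq> V}"

definition poly_ring :: "'v set \<Rightarrow> ('v, 'k::comm_ring_1) mpol ring" where
  "poly_ring V =
     \<lparr>carrier = {p. Poly_Mapping.keys p \<subseteq> expos_in V}, mult = (*), one = 1, zero = 0, add = (+)\<rparr>"

text \<open>The zero polynomial is homogeneous of every degree.\<close>

definition homogeneous_of_deg :: "nat \<Rightarrow> ('v, 'k::zero) mpol \<Rightarrow> bool" where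
  "homogeneous_of_deg n p \<longleftrightarrow> (\<forall>a\<in>Poly_Mapping.keys p. expo_deg a = n)"

text \<open>\<open>psubst f\<close> is the homomorphism of algebras that sends the variable \<open>v\<close> to \<open>f v\<close>.\<close>

definition psubst :: "('v \<Rightarrow> ('w, 'k) mpol) \<Rightarrow> ('v, 'k::comm_ring_1) mpol \<Rightarrow> ('w, 'k) mpol" where
  "psubst f p = (\<Sum>a\<in>Poly_Mapping.keys p. pconst (Poly_Mapping.lookup p a) * (\<Prod>v\<in>Poly_Mapping.keys a. f v ^ Poly_Mapping.lookup a v))"


section \<open>Invariant monomials and the toric ideal\<close>

definition GL :: "('k::field ^ 'n ^ 'n) monoid" where
  "GL = \<lparr>carrier = {A. invertible A}, mult = (**), one = mat 1\<rparr>"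

text \<open>The type \<^typ>\<open>3\<close> consists of the residues 0, 1, 2, which index the variables
  $x_0, x_1, x_2$ as well as the rows and columns of a matrix.\<close>

definition diag3 :: "'k \<Rightarrow> 'k \<Rightarrow> 'k \<Rightarrow> 'k::zero ^ 3 ^ 3" where
  "diag3 a b c = (\<chi> i j. if i = j then (if i = 0 then a else if i = 1 then b else c) else 0)"

text \<open>The linear substitution $x_i \mapsto \sum_j A_{ij} x_j$; for a diagonal matrix
  this is $x_i \mapsto g_i x_i$.\<close>

definition mat_act :: "'k::field ^ 'n ^ 'n \<Rightarrow> ('n::finite, 'k) mpol \<Rightarrow> ('n, 'k) mpol" where
  "mat_act A = psubst (\<lambda>i. \<Sum>j\<in>UNIV. pconst (A $ i $ j) * pvar j)"

definition invariant_monomials ::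
  "('k::field ^ 'n ^ 'n) set \<Rightarrow> nat \<Rightarrow> ('n::finite, 'k) mpol set" where
  "invariant_monomials G d =
     {p. (\<exists>a. p = pmonom a \<and> expo_deg a = d) \<and> (\<forall>A\<in>G. mat_act A p = p)}"

text \<open>The kernel of $K[w_v \mid v \in V] \to K[x]$, $w_v \mapsto m_v$.\<close>

definition toric_ideal ::
  "'v set \<Rightarrow> ('v \<Rightarrow> ('w, 'k::comm_ring_1) mpol) \<Rightarrow> ('v, 'k) mpol set" where
  "toric_ideal V m = a_kernel (poly_ring V) (poly_ring UNIV) (psubst m)"

definition primitive_root_of_unity :: "nat \<Rightarrow> 'k::field \<Rightarrow> bool" where
  "primitive_root_of_unity n e \<longleftrightarrow> 0 < n \<and> e ^ n = 1 \<and> (\<forall>j. 0 < j \<and> j < n \<longrightarrow> e ^ j \<noteq> 1)"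


section \<open>Quadratic Groebner bases\<close>

text \<open>\<open>(a, b) \<in> r\<close> means that the monomial with exponent \<open>a\<close> is at most the one with exponent \<open>b\<close>.\<close>

definition term_order :: "'v set \<Rightarrow> ('v expo \<times> 'v expo) set \<Rightarrow> bool" where
  "term_order V r \<longleftrightarrow>
     linear_order_on (expos_in V) r \<and>
     (\<forall>a\<in>expos_in V. (0, a) \<in> r) \<and>
     (\<forall>a b c. (a, b) \<in> r \<and> c \<in> expos_in V \<longrightarrow> (a + c, b + c) \<in> r)"

text \<open>Only meaningful for nonzero polynomials.\<close>

definition lead_expo :: "('v expo \<times> 'v expo) set \<Rightarrow> ('v, 'k::zero) mpol \<Rightarrow> 'v expo" where
  "lead_expo r p = (THE a. a \<in> Poly_Mapping.keys p \<and> (\<forall>b\<in>Poly_Mapping.keys p. (b, a) \<in> r))"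

definition initial_ideal ::
  "'v set \<Rightarrow> ('v expo \<times> 'v expo) set \<Rightarrow> ('v, 'k::comm_ring_1) mpol set \<Rightarrow> ('v, 'k) mpol set" where
  "initial_ideal V r F = genideal (poly_ring V) ((\<lambda>p. pmonom (lead_expo r p)) ` (F - {0}))"

definition groebner_basis ::
  "'v set \<Rightarrow> ('v expo \<times> 'v expo) set \<Rightarrow>
   ('v, 'k::comm_ring_1) mpol set \<Rightarrow> ('v, 'k) mpol set \<Rightarrow> bool" where
  "groebner_basis V r I F \<longleftrightarrow>
     finite F \<and> F \<subseteq> I \<and> initial_ideal V r F = initial_ideal V r I"

text \<open>A coordinate system of $S = K[w_v \mid v \in V]$, with \<open>V\<close> finite, is a family
  $(y_v)_{v \in V}$ that is a basis of the vector space $S_1$ of linear forms.\<close>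

definition coordinate_system :: "'v set \<Rightarrow> ('v \<Rightarrow> ('v, 'k::field) mpol) \<Rightarrow> bool" where
  "coordinate_system V y \<longleftrightarrow>
     inj_on y V \<and>
     \<not> Modules.module.dependent (\<lambda>c p. pconst c * p) (y ` V) \<and>
     Modules.module.span (\<lambda>c p. pconst c * p) (y ` V) =
       {p \<in> carrier (poly_ring V). homogeneous_of_deg 1 p}"

text \<open>
  Given coordinates \<open>y\<close>, a polynomial \<open>f\<close> is written in the \<open>y\<close>'s as \<open>f = psubst y g\<close>; the ideal
  below consists of these expressions \<open>g\<close> for the elements \<open>f\<close> of \<open>I\<close>. A term order on the
  monomials in the \<open>y\<close>'s is a term order on the exponents of \<open>g\<close>.
\<close>

definition ideal_in_coordinates ::
  "'v set \<Rightarrow> ('v \<Rightarrow> ('v, 'k::field) mpol) \<Rightarrow> ('v, 'k) mpol set \<Rightarrow> ('v, 'k) mpol set" where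
  "ideal_in_coordinates V y I = {g \<in> carrier (poly_ring V). psubst y g \<in> I}"

text \<open>Whether a polynomial is a nonzero quadratic form does not depend on the linear coordinates
  it is expressed in. The empty Groebner basis is admitted: it is the one of the zero ideal.\<close>

definition has_quadratic_groebner_basis ::
  "'v set \<Rightarrow> ('v, 'k::field) mpol set \<Rightarrow> bool" where
  "has_quadratic_groebner_basis V I \<longleftrightarrow>
     (\<exists>y r F. coordinate_system V y \<and> term_order V r \<and>
        groebner_basis V r (ideal_in_coordinates V y I) F \<and>
        (\<forall>g\<in>F. g \<noteq> 0 \<and> homogeneous_of_deg 2 g))"

end

theory Submission
  imports Defs
begin

text \<open>
  For an invariant monomial with exponent \<open>a\<close> put \<open>s = (a\<^sub>1 + k a\<^sub>2) / d - 1\<close> and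
  \<open>c = a\<^sub>2 - s t k\<close>. The invariant monomials of degree \<open>d\<close> are then the lattice points of the
  triangle with vertices \<open>(-1, t k)\<close>, \<open>(0, 0)\<close> and \<open>(k - 1, 0)\<close>. Weight the point \<open>(s, c)\<close> by
  \<open>(M s - c)\<^sup>2\<close> with \<open>M = t k + 1\<close> and compare monomials of \<open>S\<close> by weight, breaking ties
  lexicographically. A pair of points whose weight is minimal among all pairs with the same sum lies
  in one row \<open>s\<close> with \<open>c\<close>-coordinates at distance at most 1, or in two consecutive rows, where
  moreover the lower point has \<open>c = 0\<close> or the upper point has the largest \<open>c\<close> of its row, unless
  the lower point is \<open>(-1, t k)\<close>. Two families of points that consist of such pairs and have the
  same size and the same sum share a point: averages determine the rows that occur and how often,
  and then one of the points. Cancelling common points, the families are equal. Hence every fibre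
  of the parameterization contains exactly one monomial all of whose pairs are minimal, and the
  quadratic binomials of the ideal are a Groebner basis.
\<close>

subsection \<open>Exponents and monomials\<close>

definition expo_scale :: "nat \<Rightarrow> 'v expo \<Rightarrow> 'v expo" where
  "expo_scale n a = Poly_Mapping.map ((*) n) a"

lemma lookup_expo_scale [simp]:
  "Poly_Mapping.lookup (expo_scale n a) v = n * Poly_Mapping.lookup a v"
  by (simp add: expo_scale_def Poly_Mapping.map.rep_eq when_def)

lemma expo_scale_1 [simp]: "expo_scale (Suc 0) a = a"
  by (rule poly_mapping_eqI) simp

lemma expo_scale_0 [simp]: "expo_scale 0 a = 0"
  by (rule poly_mapping_eqI) simp

lemma expo_scale_Suc: "expo_scale (Suc n) a = a + expo_scale n a"
  by (rule poly_mapping_eqI) (simp add: lookup_add)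

lemma in_expos_in: "a \<in> expos_in V \<longleftrightarrow> (\<forall>v. v \<notin> V \<longrightarrow> Poly_Mapping.lookup a v = 0)"
  by (auto simp: expos_in_def in_keys_iff)

lemma expos_in_add: "a \<in> expos_in V \<Longrightarrow> b \<in> expos_in V \<Longrightarrow> a + b \<in> expos_in V"
  by (simp add: in_expos_in lookup_add)

lemma expos_in_single [simp]:
  "Poly_Mapping.single v n \<in> expos_in V \<longleftrightarrow> v \<in> V \<or> n = 0"
  by (auto simp: in_expos_in lookup_single when_def)

lemma single_eq_single_iff:
  "n \<noteq> 0 \<Longrightarrow> Poly_Mapping.single v n = Poly_Mapping.single w n \<longleftrightarrow> v = w"
  by (metis lookup_single_eq lookup_single_not_eq)

lemma zero_in_expos_in [simp]: "0 \<in> expos_in V"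
  by (simp add: in_expos_in)

lemma expo_deg_superset:
  "finite V \<Longrightarrow> a \<in> expos_in V \<Longrightarrow> expo_deg a = (\<Sum>v\<in>V. Poly_Mapping.lookup a v)"
  unfolding expo_deg_def by (rule sum.mono_neutral_left) (auto simp: expos_in_def in_keys_iff)

text \<open>The supports of \<open>a\<close>, \<open>b\<close> and \<open>a + b\<close> differ, so
  all three sums are extended by zero to the union. Degree, weight and each coordinate of
  \<open>expo_subst\<close> are additive as instances of this.\<close>

lemma sum_keys_add:
  fixes a b :: "'v expo"
  shows "(\<Sum>v\<in>Poly_Mapping.keys (a + b). (f v :: nat) * Poly_Mapping.lookup (a + b) v) =
    (\<Sum>v\<in>Poly_Mapping.keys a. f v * Poly_Mapping.lookup a v) +
    (\<Sum>v\<in>Poly_Mapping.keys b. f v * Poly_Mapping.lookup b v)"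
proof -
  let ?U = "Poly_Mapping.keys a \<union> Poly_Mapping.keys b"
  have *: "(\<Sum>v\<in>Poly_Mapping.keys c. f v * Poly_Mapping.lookup c v) =
      (\<Sum>v\<in>?U. f v * Poly_Mapping.lookup c v)"
    if "Poly_Mapping.keys c \<subseteq> ?U" for c
    using that by (intro sum.mono_neutral_left) (auto simp: in_keys_iff)
  show ?thesis
    by (subst (1 2 3) *)
      (auto simp: lookup_add algebra_simps sum.distrib in_keys_iff)
qed

lemma expo_deg_add: "expo_deg (a + b) = expo_deg a + expo_deg b"
  using sum_keys_add[where f = "\<lambda>_. 1"] by (simp add: expo_deg_def)

lemma expo_deg_single [simp]: "expo_deg (Poly_Mapping.single v n) = n"
  by (cases "n = 0") (simp_all add: expo_deg_def)

lemma expo_deg_0 [simp]: "expo_deg 0 = 0"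
  by (simp add: expo_deg_def)

lemma expo_deg_scale [simp]: "expo_deg (expo_scale n a) = n * expo_deg a"
  by (induction n) (simp_all add: expo_scale_Suc expo_deg_add)

lemma expo_deg_sum: "expo_deg (\<Sum>i\<in>I. f i) = (\<Sum>i\<in>I. expo_deg (f i))"
  by (induction I rule: infinite_finite_induct) (simp_all add: expo_deg_add)

lemma expo_deg_eq_0: "expo_deg a = 0 \<Longrightarrow> a = 0"
  by (rule poly_mapping_eqI) (auto simp: expo_deg_def in_keys_iff)

text \<open>Every entry is bounded by the degree, so the exponents embed into a finite box. This
  bounds the set of quadratic binomials and every fibre.\<close>

lemma finite_expos_of_deg:
  assumes "finite V"
  shows "finite {a \<in> expos_in V. expo_deg a = n}"
proof -
  have "Poly_Mapping.lookup ` {a \<in> expos_in V. expo_deg a = n} \<subseteq>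
      {f. \<forall>x. (x \<in> V \<longrightarrow> f x \<in> {..n}) \<and> (x \<notin> V \<longrightarrow> f x = 0)}"
    using assms by (auto simp: in_expos_in expo_deg_superset intro: member_le_sum)
  moreover have "finite {f. \<forall>x. (x \<in> V \<longrightarrow> f x \<in> {..n}) \<and> (x \<notin> V \<longrightarrow> f x = 0)}"
    using assms by (intro finite_set_of_finite_funs) auto
  ultimately have "finite (Poly_Mapping.lookup ` {a \<in> expos_in V. expo_deg a = n})"
    by (rule finite_subset)
  then show ?thesis
    by (rule finite_imageD) (auto simp: inj_on_def intro: poly_mapping_eqI)
qed

section \<open>Monomials, constants and monomial substitutions\<close>

lemma pmonom_0: "pmonom 0 = 1"
  by (simp add: pmonom_def)

lemma pmonom_add: "pmonom (a + b) = (pmonom a * pmonom b :: ('v, 'k::comm_ring_1) mpol)"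
  by (simp add: pmonom_def mult_single)

lemma pmonom_power: "(pmonom a :: ('v, 'k::comm_ring_1) mpol) ^ n = pmonom (expo_scale n a)"
  by (induction n) (simp_all add: pmonom_0 expo_scale_Suc pmonom_add)

lemma pmonom_sum:
  "(\<Prod>i\<in>I. pmonom (f i) :: ('v, 'k::comm_ring_1) mpol) = pmonom (\<Sum>i\<in>I. f i)"
  by (induction I rule: infinite_finite_induct) (simp_all add: pmonom_0 pmonom_add)

lemma pconst_mult: "(pconst (a * b) :: ('v, 'k::comm_ring_1) mpol) = pconst a * pconst b"
  by (simp add: pconst_def mult_single)

lemma pconst_power: "(pconst a :: ('v, 'k::comm_ring_1) mpol) ^ n = pconst (a ^ n)"
  by (induction n) (simp_all add: pconst_mult, simp add: pconst_def)

lemma pconst_prod: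
  "(\<Prod>i\<in>I. pconst (f i) :: ('v, 'k::comm_ring_1) mpol) = pconst (\<Prod>i\<in>I. f i)"
  by (induction I rule: infinite_finite_induct) (simp_all add: pconst_mult, simp_all add: pconst_def)

lemma pconst_mult_pmonom:
  "pconst c * pmonom a = (Poly_Mapping.single a c :: ('v, 'k::comm_ring_1) mpol)"
  by (simp add: pconst_def pmonom_def mult_single)

lemma keys_pmonom [simp]:
  "Poly_Mapping.keys (pmonom a :: ('v, 'k::zero_neq_one) mpol) = {a}"
  by (simp add: pmonom_def)

lemma pmonom_eq_iff [simp]:
  "(pmonom a :: ('v, 'k::zero_neq_one) mpol) = pmonom b \<longleftrightarrow> a = b"
  by (metis keys_pmonom the_elem_eq)

lemma sum_singles:
  "(\<Sum>a\<in>Poly_Mapping.keys p. Poly_Mapping.single a (Poly_Mapping.lookup p a)) = p"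
  by (rule poly_mapping_eqI)
    (auto simp: lookup_sum lookup_single when_def in_keys_iff)

text \<open>The linear map whose matrix has the columns \<open>\<alpha> i\<close>: it describes on
  exponents the substitution of the monomial \<open>\<alpha> i\<close> for the variable
  \<open>i\<close>.\<close>

definition expo_subst :: "('v \<Rightarrow> 'w expo) \<Rightarrow> 'v expo \<Rightarrow> 'w expo" where
  "expo_subst \<alpha> u = (\<Sum>i\<in>Poly_Mapping.keys u. expo_scale (Poly_Mapping.lookup u i) (\<alpha> i))"

lemma lookup_expo_subst:
  assumes "finite V" "u \<in> expos_in V"
  shows "Poly_Mapping.lookup (expo_subst \<alpha> u) x =
    (\<Sum>i\<in>V. Poly_Mapping.lookup u i * Poly_Mapping.lookup (\<alpha> i) x)"
  unfolding expo_subst_def lookup_sum lookup_expo_scale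
  using assms by (intro sum.mono_neutral_left) (auto simp: expos_in_def in_keys_iff)

lemma expo_subst_add: "expo_subst \<alpha> (u + v) = expo_subst \<alpha> u + expo_subst \<alpha> v"
  using sum_keys_add[where f = "\<lambda>i. Poly_Mapping.lookup (\<alpha> i) x" for x]
  by (intro poly_mapping_eqI) (simp add: expo_subst_def lookup_sum lookup_add mult.commute)

lemma expo_subst_single [simp]: "expo_subst \<alpha> (Poly_Mapping.single i (Suc 0)) = \<alpha> i"
  by (simp add: expo_subst_def)

lemma expo_deg_subst:
  assumes "u \<in> expos_in V" "\<And>i. i \<in> V \<Longrightarrow> expo_deg (\<alpha> i) = d"
  shows "expo_deg (expo_subst \<alpha> u) = d * expo_deg u"
  using assms unfolding expo_subst_def expo_deg_sum
  by (auto simp: expo_deg_def[of u] sum_distrib_left expos_in_def intro!: sum.cong)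

lemma psubst_monomials:
  fixes p :: "('v, 'k::comm_ring_1) mpol"
  assumes "Poly_Mapping.keys p \<subseteq> expos_in V" "\<And>i. i \<in> V \<Longrightarrow> m i = pmonom (\<alpha> i)"
  shows "psubst m p =
    (\<Sum>u\<in>Poly_Mapping.keys p. Poly_Mapping.single (expo_subst \<alpha> u) (Poly_Mapping.lookup p u))"
  unfolding psubst_def
proof (rule sum.cong)
  fix u assume "u \<in> Poly_Mapping.keys p"
  then have "(\<Prod>v\<in>Poly_Mapping.keys u. m v ^ Poly_Mapping.lookup u v) =
      (\<Prod>v\<in>Poly_Mapping.keys u. pmonom (expo_scale (Poly_Mapping.lookup u v) (\<alpha> v)))"
    using assms(1) by (intro prod.cong) (simp_all add: assms(2) pmonom_power expos_in_def subset_iff)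
  then show "pconst (Poly_Mapping.lookup p u) *
      (\<Prod>v\<in>Poly_Mapping.keys u. m v ^ Poly_Mapping.lookup u v) =
      Poly_Mapping.single (expo_subst \<alpha> u) (Poly_Mapping.lookup p u)"
    by (simp add: pmonom_sum expo_subst_def pconst_mult_pmonom)
qed simp

text \<open>This identifies an ideal with its expression in the standard coordinates, and it
  rebuilds a monomial from its variables when a diagonal matrix acts.\<close>

lemma psubst_pvar: "psubst pvar p = (p :: ('v, 'k::comm_ring_1) mpol)"
proof -
  have "expo_subst (\<lambda>i. Poly_Mapping.single i 1) u = u" for u :: "'v expo"
    by (rule poly_mapping_eqI)
      (auto simp: expo_subst_def lookup_sum lookup_single when_def in_keys_iff
        if_distrib[of "\<lambda>x. _ * x"] cong: if_cong)
  then show ?thesis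
    using psubst_monomials[of p UNIV pvar "\<lambda>i. Poly_Mapping.single i 1"]
    by (simp add: expos_in_def pvar_def sum_singles)
qed

lemma psubst_pmonom:
  "psubst f (pmonom a) = (\<Prod>v\<in>Poly_Mapping.keys a. f v ^ Poly_Mapping.lookup a v :: ('w, 'k::comm_ring_1) mpol)"
  by (simp add: psubst_def) (simp add: pmonom_def pconst_def)

subsection \<open>The standard coordinates\<close>

lemma coordinate_system_pvar:
  assumes V: "finite V"
  shows "coordinate_system V (pvar :: 'v \<Rightarrow> ('v, 'k::field) mpol)"
proof -
  interpret vector_space "\<lambda>c p. pconst c * (p :: ('v, 'k) mpol)"
    by unfold_locales
      (simp_all add: algebra_simps pconst_mult, simp_all add: pconst_def single_add distrib_left)
  have inj: "inj_on (pvar :: 'v \<Rightarrow> ('v, 'k) mpol) V"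
    by (auto simp: inj_on_def pvar_def single_eq_single_iff)
  \<comment> \<open>Reading off the coefficient of one variable turns a vanishing combination into
    vanishing scalars.\<close>
  have look: "Poly_Mapping.lookup (\<Sum>v\<in>V. pconst (c v) * pvar v :: ('v, 'k) mpol)
      (Poly_Mapping.single w 1)
      = (if w \<in> V then c w else 0)" for c w
  proof -
    show ?thesis
      using V by (simp add: pvar_def pconst_mult_pmonom lookup_sum lookup_single when_def single_eq_single_iff)
  qed
  have indep: "independent (pvar ` V :: ('v, 'k) mpol set)"
  proof (subst independent_if_scalars_zero)
    show "finite (pvar ` V :: ('v, 'k) mpol set)"
      using V by simp
  next
    fix f :: "('v, 'k) mpol \<Rightarrow> 'k" and x :: "('v, 'k) mpol"
    assume z: "(\<Sum>x\<in>pvar ` V. pconst (f x) * x) = 0" and "x \<in> pvar ` V"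
    then obtain w where w: "w \<in> V" "x = pvar w" by auto
    have "(\<Sum>v\<in>V. pconst (f (pvar v)) * pvar v :: ('v, 'k) mpol) = 0"
      using z by (simp add: sum.reindex[OF inj])
    then show "f x = 0"
      using look[of "\<lambda>v. f (pvar v)" w] w by simp
  qed simp
  have "span (pvar ` V) = {p \<in> carrier (poly_ring V). homogeneous_of_deg 1 (p :: ('v, 'k) mpol)}"
    (is "_ = ?S")
  proof
    have "subspace ?S"
    proof (rule subspaceI)
      show "0 \<in> ?S" by (simp add: poly_ring_def homogeneous_of_deg_def)
    next
      fix p q :: "('v, 'k) mpol" assume "p \<in> ?S" "q \<in> ?S"
      then show "p + q \<in> ?S"
        using Poly_Mapping.keys_add[of p q] by (auto simp: poly_ring_def homogeneous_of_deg_def)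
    next
      fix c and p :: "('v, 'k) mpol" assume "p \<in> ?S"
      moreover have "Poly_Mapping.keys (pconst c * p) \<subseteq> Poly_Mapping.keys p"
        using keys_mult[of "pconst c" p] by (auto simp: pconst_def split: if_splits)
      ultimately show "pconst c * p \<in> ?S"
        by (auto simp: poly_ring_def homogeneous_of_deg_def)
    qed
    moreover have "pvar ` V \<subseteq> ?S"
      by (auto simp: poly_ring_def homogeneous_of_deg_def pvar_def)
    ultimately show "span (pvar ` V) \<subseteq> ?S"
      by (rule span_minimal[rotated])
  next
    show "?S \<subseteq> span (pvar ` V)"
    proof
      fix p :: "('v, 'k) mpol" assume p: "p \<in> ?S"
      have "Poly_Mapping.single a (Poly_Mapping.lookup p a) \<in> span (pvar ` V)"
        if a: "a \<in> Poly_Mapping.keys p" for a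
      proof -
        have aV: "a \<in> expos_in V" "expo_deg a = 1"
          using p a by (auto simp: poly_ring_def homogeneous_of_deg_def)
        then have "a \<noteq> 0" by auto
        then obtain v where v: "v \<in> Poly_Mapping.keys a" by fastforce
        then have "v \<in> V" "Poly_Mapping.lookup a v > 0"
          using aV by (auto simp: expos_in_def in_keys_iff)
        have "a = Poly_Mapping.single v 1 + (a - Poly_Mapping.single v 1)"
          using \<open>Poly_Mapping.lookup a v > 0\<close>
          by (intro poly_mapping_eqI) (auto simp: lookup_add lookup_minus lookup_single when_def)
        then have "a = Poly_Mapping.single v 1"
          using aV(2) by (metis expo_deg_add expo_deg_eq_0 expo_deg_single add.right_neutral add_left_cancel)
        then have "Poly_Mapping.single a (Poly_Mapping.lookup p a) =
            pconst (Poly_Mapping.lookup p a) * pvar v"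
          by (simp add: pvar_def pconst_mult_pmonom)
        then show ?thesis
          using span_scale[OF span_base, of "pvar v" "pvar ` V"] \<open>v \<in> V\<close> by simp
      qed
      then have "(\<Sum>a\<in>Poly_Mapping.keys p. Poly_Mapping.single a (Poly_Mapping.lookup p a)) \<in> span (pvar ` V)"
        by (rule span_sum)
      then show "p \<in> span (pvar ` V)" by (simp add: sum_singles)
    qed
  qed
  with inj indep show ?thesis
    unfolding coordinate_system_def by simp
qed

subsection \<open>A criterion for quadratic Groebner bases of toric ideals\<close>

text \<open>Used with the term order for the leading exponent of a polynomial, and with its converse
  for the smallest exponent of a fibre.\<close>

lemma linear_order_on_finite_max:
  assumes "linear_order_on A r" "finite S" "S \<noteq> {}" "S \<subseteq> A"
  obtains x where "x \<in> S" "\<forall>y\<in>S. (y, x) \<in> r"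
proof -
  have "\<exists>x\<in>S. \<forall>y\<in>S. (y, x) \<in> r"
    using assms(2-4)
  proof (induction S rule: finite_ne_induct)
    case (singleton x)
    then show ?case
      using assms(1) by (auto simp: order_on_defs refl_on_def)
  next
    case (insert z S)
    then obtain x where x: "x \<in> S" "\<forall>y\<in>S. (y, x) \<in> r" by auto
    have "(x, z) \<in> r \<or> (z, x) \<in> r"
      using assms(1) insert x by (auto simp: order_on_defs total_on_def)
    moreover have "(z, z) \<in> r"
      using assms(1) insert by (auto simp: order_on_defs refl_on_def)
    moreover have "trans r"
      using assms(1) by (simp add: order_on_defs)
    ultimately show ?case
      using x by (auto dest: transD)
  qed
  then show ?thesis using that by blast
qed

lemma lead_expo_eqI:
  assumes "antisym r" "a \<in> Poly_Mapping.keys p" "\<And>b. b \<in> Poly_Mapping.keys p \<Longrightarrow> (b, a) \<in> r"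
  shows "lead_expo r p = a"
  unfolding lead_expo_def using assms by (auto dest: antisymD)

section \<open>Weight orders and membership in the toric ideal\<close>

definition expo_weight :: "('v \<Rightarrow> nat) \<Rightarrow> 'v expo \<Rightarrow> nat" where
  "expo_weight \<omega> a = (\<Sum>v\<in>Poly_Mapping.keys a. \<omega> v * Poly_Mapping.lookup a v)"

lemma expo_weight_add: "expo_weight \<omega> (a + b) = expo_weight \<omega> a + expo_weight \<omega> b"
  unfolding expo_weight_def by (rule sum_keys_add)

lemma expo_weight_single [simp]: "expo_weight \<omega> (Poly_Mapping.single v (Suc 0)) = \<omega> v"
  by (simp add: expo_weight_def)

text \<open>Ties are decided by \<open>\<le>\<close> on finitely supported maps, which is
  lexicographic in the order of the variables; this makes the order total.\<close>

definition weight_order :: "'v::linorder set \<Rightarrow> ('v \<Rightarrow> nat) \<Rightarrow> ('v expo \<times> 'v expo) set" where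
  "weight_order V \<omega> = {(a, b). a \<in> expos_in V \<and> b \<in> expos_in V \<and>
     (expo_weight \<omega> a < expo_weight \<omega> b \<or> expo_weight \<omega> a = expo_weight \<omega> b \<and> a \<le> b)}"

lemma zero_le_expo: "0 \<le> (a :: 'v::linorder expo)"
proof (rule ccontr)
  assume "\<not> 0 \<le> a"
  then have "a < 0" by simp
  then show False
    by transfer (auto simp: less_fun_def)
qed

lemma term_order_weight_order: "term_order V (weight_order V \<omega>)"
proof -
  have "linear_order_on (expos_in V) (weight_order V \<omega>)"
    by (auto simp: order_on_defs weight_order_def refl_on_def trans_def antisym_def total_on_def)
  moreover have "(0, a) \<in> weight_order V \<omega>" if "a \<in> expos_in V" for a
    using that zero_le_expo[of a] by (auto simp: weight_order_def expo_weight_def[of _ 0])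
  moreover have "(a + c, b + c) \<in> weight_order V \<omega>"
    if "(a, b) \<in> weight_order V \<omega>" "c \<in> expos_in V" for a b c
    using that by (auto simp: weight_order_def expo_weight_add expos_in_add intro: add_right_mono)
  ultimately show ?thesis
    unfolding term_order_def by blast
qed

text \<open>A coefficient of the image polynomial collects the coefficients of one fibre of
  \<open>expo_subst \<alpha>\<close>, so the kernel condition separates into one equation per
  fibre.\<close>

lemma toric_ideal_iff:
  fixes m :: "'v \<Rightarrow> ('w, 'k::comm_ring_1) mpol"
  assumes "\<And>i. i \<in> V \<Longrightarrow> m i = pmonom (\<alpha> i)"
  shows "p \<in> toric_ideal V m \<longleftrightarrow> Poly_Mapping.keys p \<subseteq> expos_in V \<and>
    (\<forall>x. (\<Sum>u | u \<in> Poly_Mapping.keys p \<and> expo_subst \<alpha> u = x. Poly_Mapping.lookup p u) = 0)"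
proof (cases "Poly_Mapping.keys p \<subseteq> expos_in V")
  case True
  have "Poly_Mapping.lookup (psubst m p) x =
      (\<Sum>u | u \<in> Poly_Mapping.keys p \<and> expo_subst \<alpha> u = x. Poly_Mapping.lookup p u)" for x
    by (subst psubst_monomials[OF True assms])
      (simp_all add: lookup_sum lookup_single when_def sum.If_cases Int_def)
  then have "psubst m p = 0 \<longleftrightarrow>
      (\<forall>x. (\<Sum>u | u \<in> Poly_Mapping.keys p \<and> expo_subst \<alpha> u = x. Poly_Mapping.lookup p u) = 0)"
    by (metis lookup_zero poly_mapping_eqI)
  then show ?thesis
    using True by (simp add: toric_ideal_def a_kernel_def' poly_ring_def)
qed (simp add: toric_ideal_def a_kernel_def' poly_ring_def)

lemma keys_binomial:
  "a \<noteq> b \<Longrightarrow> Poly_Mapping.keys (pmonom a - pmonom b :: ('v, 'k::comm_ring_1) mpol) = {a, b}"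
  by (auto simp: in_keys_iff pmonom_def lookup_minus lookup_single when_def split: if_splits)

lemma binomial_in_toric_ideal:
  fixes m :: "'v \<Rightarrow> ('w, 'k::comm_ring_1) mpol"
  assumes "\<And>i. i \<in> V \<Longrightarrow> m i = pmonom (\<alpha> i)"
    and "a \<in> expos_in V" "b \<in> expos_in V" "expo_subst \<alpha> a = expo_subst \<alpha> b" "a \<noteq> b"
  shows "pmonom a - pmonom b \<in> toric_ideal V m"
proof -
  have "(\<Sum>u | u \<in> {a, b} \<and> expo_subst \<alpha> u = x.
      Poly_Mapping.lookup (pmonom a - pmonom b :: ('v, 'k) mpol) u) = 0" for x
  proof (cases "expo_subst \<alpha> a = x")
    case True
    then have "{u. u \<in> {a, b} \<and> expo_subst \<alpha> u = x} = {a, b}"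
      using assms by auto
    then show ?thesis
      using assms by (simp add: pmonom_def lookup_minus lookup_single)
  next
    case False
    then have "{u. u \<in> {a, b} \<and> expo_subst \<alpha> u = x} = {}"
      using assms by auto
    then show ?thesis by (simp only: sum.empty)
  qed
  then show ?thesis
    using assms by (auto simp: toric_ideal_iff[OF assms(1)] keys_binomial)
qed

text \<open>For two distinct variables, membership in the support already means that their product
  divides the monomial. The condition therefore depends on the support alone and is inherited by
  divisors.\<close>

definition pair_minimal ::
  "'v set \<Rightarrow> ('v \<Rightarrow> 'w expo) \<Rightarrow> ('v \<Rightarrow> nat) \<Rightarrow> 'v expo \<Rightarrow> bool" where
  "pair_minimal V \<alpha> \<omega> u \<longleftrightarrow>
    (\<forall>i\<in>Poly_Mapping.keys u. \<forall>j\<in>Poly_Mapping.keys u. \<forall>i'\<in>V. \<forall>j'\<in>V.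
       i \<noteq> j \<longrightarrow> \<alpha> i + \<alpha> j = \<alpha> i' + \<alpha> j' \<longrightarrow> \<omega> i + \<omega> j \<le> \<omega> i' + \<omega> j')"

text \<open>The offending pair is the factor \<open>a\<close>, its lighter replacement is
  \<open>b\<close>, and \<open>c\<close> is the untouched cofactor.\<close>

lemma not_pair_minimalE:
  assumes "\<not> pair_minimal V \<alpha> \<omega> u" "u \<in> expos_in V"
  obtains a b c where "u = a + c" "a \<in> expos_in V" "b \<in> expos_in V" "c \<in> expos_in V"
    "expo_deg a = 2" "expo_deg b = 2" "expo_subst \<alpha> a = expo_subst \<alpha> b"
    "expo_weight \<omega> b < expo_weight \<omega> a"
proof -
  from assms(1) obtain i j i' j' where ij: "i \<in> Poly_Mapping.keys u" "j \<in> Poly_Mapping.keys u"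
      "i' \<in> V" "j' \<in> V" "i \<noteq> j" "\<alpha> i + \<alpha> j = \<alpha> i' + \<alpha> j'" "\<omega> i' + \<omega> j' < \<omega> i + \<omega> j"
    unfolding pair_minimal_def by (auto simp: not_le)
  define a where "a = Poly_Mapping.single i 1 + Poly_Mapping.single j (1::nat)"
  define b where "b = Poly_Mapping.single i' 1 + Poly_Mapping.single j' (1::nat)"
  have "i \<in> V" "j \<in> V" using ij assms(2) by (auto simp: expos_in_def)
  then have V: "a \<in> expos_in V" "b \<in> expos_in V"
    using ij unfolding a_def b_def by (auto intro!: expos_in_add)
  have "u = a + (u - a)"
    using ij(1,2,5) unfolding a_def
    by (intro poly_mapping_eqI) (auto simp: lookup_add lookup_minus lookup_single when_def in_keys_iff)
  moreover have "u - a \<in> expos_in V"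
    using assms(2) by (simp add: in_expos_in lookup_minus)
  ultimately show ?thesis
    using that[of a "u - a" b] V ij
    by (simp add: a_def b_def expo_deg_add expo_weight_add expo_subst_add)
qed

text \<open>Induction on the degree, which the fibre determines since \<open>d > 0\<close>: a common
  variable is cancelled from both exponents, and the quotients are again pair minimal with equal
  images.\<close>

lemma pair_minimal_unique:
  assumes deg: "\<And>i. i \<in> V \<Longrightarrow> expo_deg (\<alpha> i) = d" and "d > 0"
    and common: "\<And>u v. \<lbrakk>u \<in> expos_in V; v \<in> expos_in V; u \<noteq> 0; v \<noteq> 0;
      expo_subst \<alpha> u = expo_subst \<alpha> v; pair_minimal V \<alpha> \<omega> u; pair_minimal V \<alpha> \<omega> v\<rbrakk>
      \<Longrightarrow> Poly_Mapping.keys u \<inter> Poly_Mapping.keys v \<noteq> {}"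
    and "u \<in> expos_in V" "v \<in> expos_in V" "expo_subst \<alpha> u = expo_subst \<alpha> v"
    and "pair_minimal V \<alpha> \<omega> u" "pair_minimal V \<alpha> \<omega> v"
  shows "u = v"
  using assms(4-8)
proof (induction "expo_deg u" arbitrary: u v rule: less_induct)
  case less
  have "d * expo_deg u = d * expo_deg v"
    using expo_deg_subst[where V = V and \<alpha> = \<alpha> and d = d] deg less.prems by metis
  then have eq: "expo_deg u = expo_deg v" using \<open>d > 0\<close> by simp
  show ?case
  proof (cases "u = 0 \<or> v = 0")
    case True
    then show ?thesis using eq expo_deg_eq_0 by (metis expo_deg_0)
  next
    case False
    then obtain i where i: "i \<in> Poly_Mapping.keys u" "i \<in> Poly_Mapping.keys v"
      using common less.prems by blast
    define x where "x = Poly_Mapping.single i (1::nat)"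
    have split: "u = x + (u - x)" "v = x + (v - x)"
      using i unfolding x_def
      by (auto intro!: poly_mapping_eqI simp: lookup_add lookup_minus lookup_single when_def in_keys_iff)
    have "expo_deg u = 1 + expo_deg (u - x)"
      by (subst split(1)) (simp add: expo_deg_add x_def)
    moreover have "expo_subst \<alpha> (u - x) = expo_subst \<alpha> (v - x)"
      using less.prems(3) split expo_subst_add[of \<alpha> x] by (metis add_left_cancel)
    moreover have "w - x \<in> expos_in V" "pair_minimal V \<alpha> \<omega> (w - x)"
      if "w \<in> expos_in V" "pair_minimal V \<alpha> \<omega> w" for w
    proof -
      have "Poly_Mapping.keys (w - x) \<subseteq> Poly_Mapping.keys w"
        by (auto simp: in_keys_iff lookup_minus)
      then show "w - x \<in> expos_in V" "pair_minimal V \<alpha> \<omega> (w - x)"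
        using that unfolding pair_minimal_def expos_in_def by blast+
    qed
    ultimately have "u - x = v - x"
      using less.hyps[of "u - x" "v - x"] less.prems by simp
    then show ?thesis using split by metis
  qed
qed

text \<open>A smallest exponent of a fibre of the parameterization is pair minimal, so uniqueness of
  pair minimal exponents in each fibre means that every monomial which is not the smallest of its
  fibre is divisible by the leading monomial of a quadratic binomial.\<close>

lemma quadratic_groebner_basis_criterion:
  fixes m :: "'v::linorder \<Rightarrow> ('w, 'k::field) mpol"
  assumes V: "finite V"
    and m: "\<And>i. i \<in> V \<Longrightarrow> m i = pmonom (\<alpha> i)"
    and deg: "\<And>i. i \<in> V \<Longrightarrow> expo_deg (\<alpha> i) = d" and "d > 0"
    and unique: "\<And>u v. \<lbrakk>u \<in> expos_in V; v \<in> expos_in V; expo_subst \<alpha> u = expo_subst \<alpha> v;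
      pair_minimal V \<alpha> \<omega> u; pair_minimal V \<alpha> \<omega> v\<rbrakk> \<Longrightarrow> u = v"
  shows "has_quadratic_groebner_basis V (toric_ideal V m)"
proof -
  define r where "r = weight_order V \<omega>"
  define I where "I = toric_ideal V m"
  \<comment> \<open>The strict inequality of weights makes \<open>a\<close> the leading exponent
    without consulting the tie-break.\<close>
  define F :: "('v, 'k) mpol set" where "F = {pmonom a - pmonom b | a b. a \<in> expos_in V \<and> b \<in> expos_in V \<and>
     expo_deg a = 2 \<and> expo_deg b = 2 \<and> expo_subst \<alpha> a = expo_subst \<alpha> b \<and> expo_weight \<omega> b < expo_weight \<omega> a}"
  have r: "term_order V r" "linear_order_on (expos_in V) r" "antisym r"
    using term_order_weight_order[of V \<omega>] by (auto simp: r_def term_order_def order_on_defs)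
  have I_coord: "ideal_in_coordinates V pvar I = I"
    by (auto simp: ideal_in_coordinates_def psubst_pvar I_def toric_ideal_def a_kernel_def')
  let ?D = "{a \<in> expos_in V. expo_deg a = 2}"
  have "F \<subseteq> (\<lambda>(a, b). pmonom a - pmonom b) ` (?D \<times> ?D)"
    by (auto simp: F_def)
  then have "finite F"
    by (rule finite_subset) (intro finite_imageI finite_cartesian_product finite_expos_of_deg V)
  have "F \<subseteq> I"
    by (auto simp: F_def I_def intro!: binomial_in_toric_ideal[OF m])
  have F_quadratic: "g \<noteq> 0 \<and> homogeneous_of_deg 2 g" if "g \<in> F" for g
  proof -
    from that obtain a b where ab: "g = pmonom a - pmonom b" "a \<noteq> b"
        "expo_deg a = 2" "expo_deg b = 2"
      by (auto simp: F_def)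
    then have "Poly_Mapping.keys g = {a, b}" by (simp add: keys_binomial)
    with ab show ?thesis by (auto simp: homogeneous_of_deg_def)
  qed
  have lead_divisible: "\<exists>g\<in>F. \<exists>c\<in>expos_in V. lead_expo r p = lead_expo r g + c"
    if p: "p \<in> I" "p \<noteq> 0" for p
  proof -
    have pV: "Poly_Mapping.keys p \<subseteq> expos_in V"
      and fibre: "(\<Sum>u | u \<in> Poly_Mapping.keys p \<and> expo_subst \<alpha> u = x. Poly_Mapping.lookup p u) = 0" for x
      using p by (simp_all add: I_def toric_ideal_iff[OF m])
    obtain u where u: "u \<in> Poly_Mapping.keys p" "\<forall>v\<in>Poly_Mapping.keys p. (v, u) \<in> r"
      using linear_order_on_finite_max[OF r(2), of "Poly_Mapping.keys p"] p(2) pV by auto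
    have lead: "lead_expo r p = u"
      by (rule lead_expo_eqI) (use u r in auto)
    \<comment> \<open>A pair minimal \<open>u\<close> would be the smallest exponent of its fibre.
      But the coefficients of \<open>p\<close> cancel in that fibre, which forces a second exponent
      of \<open>p\<close> there, and it lies below the leading exponent \<open>u\<close>.\<close>
    have "\<not> pair_minimal V \<alpha> \<omega> u"
    proof
      assume min: "pair_minimal V \<alpha> \<omega> u"
      have "\<exists>v\<in>Poly_Mapping.keys p. v \<noteq> u \<and> expo_subst \<alpha> v = expo_subst \<alpha> u"
      proof (rule ccontr)
        assume "\<not> ?thesis"
        then have "{v. v \<in> Poly_Mapping.keys p \<and> expo_subst \<alpha> v = expo_subst \<alpha> u} = {u}"
          using u by auto
        then show False
          using fibre[of "expo_subst \<alpha> u"] u by (simp add: in_keys_iff)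
      qed
      then obtain v where v: "v \<in> Poly_Mapping.keys p" "v \<noteq> u" "expo_subst \<alpha> v = expo_subst \<alpha> u"
        by auto
      \<comment> \<open>The fibre has constant degree, hence is finite and has a smallest element
        \<open>w\<close>; a violating pair in \<open>w\<close> would produce the lighter element
        \<open>b + c\<close>.\<close>
      let ?S = "{w \<in> expos_in V. expo_subst \<alpha> w = expo_subst \<alpha> u}"
      have "?S \<subseteq> {w \<in> expos_in V. expo_deg w = expo_deg u}"
      proof safe
        fix w assume "w \<in> expos_in V" "expo_subst \<alpha> w = expo_subst \<alpha> u"
        then have "d * expo_deg w = d * expo_deg u"
          using expo_deg_subst[where V = V and \<alpha> = \<alpha> and d = d] deg u pV by (metis subsetD)
        then show "expo_deg w = expo_deg u" using \<open>d > 0\<close> by simp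
      qed
      then have "finite ?S"
        by (rule finite_subset) (rule finite_expos_of_deg[OF V])
      moreover have "u \<in> ?S" using u pV by auto
      moreover have "linear_order_on (expos_in V) (r\<inverse>)"
        using r by (simp add: linear_order_on_converse)
      ultimately obtain w where w: "w \<in> ?S" "\<forall>w'\<in>?S. (w', w) \<in> r\<inverse>"
        using linear_order_on_finite_max[of "expos_in V" "r\<inverse>" ?S] by blast
      have "pair_minimal V \<alpha> \<omega> w"
      proof (rule ccontr)
        assume "\<not> pair_minimal V \<alpha> \<omega> w"
        then obtain a b c where abc: "w = a + c" "b \<in> expos_in V" "c \<in> expos_in V"
            "expo_subst \<alpha> a = expo_subst \<alpha> b" "expo_weight \<omega> b < expo_weight \<omega> a"
          using w by (auto elim!: not_pair_minimalE)
        then have "b + c \<in> ?S"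
          using w by (auto simp: expo_subst_add expos_in_add)
        then have "(w, b + c) \<in> r" using w by auto
        then show False
          using abc by (simp add: r_def weight_order_def expo_weight_add)
      qed
      then have "w = u"
        using unique[of w u] w min u pV by auto
      moreover have "(w, v) \<in> r" using w v pV by auto
      moreover have "(v, u) \<in> r" using u v by auto
      ultimately show False using v r by (auto dest: antisymD)
    qed
    then obtain a b c where abc: "u = a + c" "a \<in> expos_in V" "b \<in> expos_in V" "c \<in> expos_in V"
        "expo_deg a = 2" "expo_deg b = 2" "expo_subst \<alpha> a = expo_subst \<alpha> b"
        "expo_weight \<omega> b < expo_weight \<omega> a"
      using u pV by (auto elim!: not_pair_minimalE)
    define g :: "('v, 'k) mpol" where "g = pmonom a - pmonom b"
    have "g \<in> F" using abc by (auto simp: F_def g_def)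
    moreover have "Poly_Mapping.keys g = {a, b}"
      unfolding g_def by (rule keys_binomial) (use abc in auto)
    then have "lead_expo r g = a"
      using abc by (intro lead_expo_eqI[OF r(3)]) (auto simp: r_def weight_order_def)
    ultimately show ?thesis
      using abc lead by blast
  qed
  have "initial_ideal V r F = initial_ideal V r I"
  proof
    show "initial_ideal V r F \<subseteq> initial_ideal V r I"
      using \<open>F \<subseteq> I\<close> unfolding initial_ideal_def genideal_def by blast
  next
    have "pmonom (lead_expo r p) \<in> J"
      if J: "ideal J (poly_ring V)" "(\<lambda>p. pmonom (lead_expo r p)) ` (F - {0}) \<subseteq> J"
        and p: "p \<in> I - {0}" for J and p :: "('v, 'k) mpol"
    proof -
      obtain g c where g: "g \<in> F" "c \<in> expos_in V" "lead_expo r p = c + lead_expo r g"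
        using lead_divisible[of p] p by (auto simp: add.commute)
      have "pmonom (lead_expo r g) \<in> J"
        using J(2) g F_quadratic by blast
      moreover have "pmonom c \<in> carrier (poly_ring V)"
        using g by (simp add: poly_ring_def)
      ultimately have "mult (poly_ring V) (pmonom c) (pmonom (lead_expo r g)) \<in> J"
        by (rule ideal.I_l_closed[OF J(1)])
      then show ?thesis
        by (simp add: g(3) pmonom_add poly_ring_def)
    qed
    then show "initial_ideal V r I \<subseteq> initial_ideal V r F"
      unfolding initial_ideal_def genideal_def by blast
  qed
  then have "groebner_basis V r (ideal_in_coordinates V pvar I) F"
    using \<open>finite F\<close> \<open>F \<subseteq> I\<close> by (simp add: groebner_basis_def I_coord)
  then show ?thesis
    unfolding has_quadratic_groebner_basis_def I_def
    using coordinate_system_pvar[OF V] r(1) F_quadratic by blast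
qed

subsection \<open>The lattice points of the polygon\<close>

text \<open>Here \<open>n\<close> is \<open>k - 1\<close>. The edge \<open>c = t * (n - s)\<close>
  passes through the apex at \<open>s = -1\<close>; the apex is the only point of its row, hence the
  separate \<open>insert\<close>.\<close>

definition polygon_points :: "int \<Rightarrow> int \<Rightarrow> (int \<times> int) set" where
  "polygon_points t n =
    insert (-1, t * (n + 1)) {(s, c). 0 \<le> s \<and> s \<le> n \<and> 0 \<le> c \<and> c \<le> t * (n - s)}"

text \<open>The factor \<open>t * (n + 1) + 1\<close> exceeds every \<open>c\<close> in the polygon,
  so the linear form inside the square orders points by row and then by decreasing \<open>c\<close>.
  For two points with fixed sum, the total weight depends only on the distance between their values
  of this form.\<close>

definition point_weight :: "int \<Rightarrow> int \<Rightarrow> int \<times> int \<Rightarrow> int" where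
  "point_weight t n p = ((t * (n + 1) + 1) * fst p - snd p)\<^sup>2"

definition minimal_pair :: "int \<Rightarrow> int \<Rightarrow> int \<times> int \<Rightarrow> int \<times> int \<Rightarrow> bool" where
  "minimal_pair t n p q \<longleftrightarrow>
    (\<forall>p'\<in>polygon_points t n. \<forall>q'\<in>polygon_points t n. p' + q' = p + q \<longrightarrow>
       point_weight t n p + point_weight t n q \<le> point_weight t n p' + point_weight t n q')"

text \<open>Twice the sum of two squares is the square of the sum plus the square of the
  difference.\<close>

lemma sum_squares_closer:
  fixes a b x y :: int
  assumes "a + b = x + y" "x - y < b - a" "y - x < b - a"
  shows "x\<^sup>2 + y\<^sup>2 < a\<^sup>2 + b\<^sup>2"
proof -
  have "\<bar>x - y\<bar> < \<bar>b - a\<bar>" using assms by linarith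
  then have "(x - y)\<^sup>2 < (b - a)\<^sup>2" by (simp add: power2_strict_mono)
  moreover have "(x + y)\<^sup>2 = (a + b)\<^sup>2" using assms by simp
  ultimately show ?thesis by (simp add: power2_eq_square algebra_simps)
qed

text \<open>An exchange move: \<open>(i, j)\<close> is added to one point and subtracted from the
  other, which has the larger value of the linear form. The last two assumptions say that the values
  come strictly closer.\<close>

lemma not_minimal_pair:
  assumes "(s1 + i, c1 + j) \<in> polygon_points t n" "(s2 - i, c2 - j) \<in> polygon_points t n"
    and "M = t * (n + 1) + 1"
    and "(M * (s1 + i) - (c1 + j)) - (M * (s2 - i) - (c2 - j)) < (M * s2 - c2) - (M * s1 - c1)"
    and "(M * (s2 - i) - (c2 - j)) - (M * (s1 + i) - (c1 + j)) < (M * s2 - c2) - (M * s1 - c1)"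
  shows "\<not> minimal_pair t n (s1, c1) (s2, c2)"
proof -
  have "(M * (s1 + i) - (c1 + j))\<^sup>2 + (M * (s2 - i) - (c2 - j))\<^sup>2 <
      (M * s1 - c1)\<^sup>2 + (M * s2 - c2)\<^sup>2"
    by (rule sum_squares_closer) (use assms(4,5) in \<open>simp_all add: algebra_simps\<close>)
  then have "point_weight t n (s1 + i, c1 + j) + point_weight t n (s2 - i, c2 - j) <
      point_weight t n (s1, c1) + point_weight t n (s2, c2)"
    unfolding point_weight_def assms(3) by simp
  moreover have "(s1 + i, c1 + j) + (s2 - i, c2 - j) = (s1, c1) + (s2, c2)" by simp
  ultimately show ?thesis
    unfolding minimal_pair_def using assms(1,2) by (metis not_le)
qed

section \<open>Constraints on minimal pairs\<close>

lemma polygon_pointsD: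
  assumes "(s, c) \<in> polygon_points t n" "t \<ge> 0" "n \<ge> 0"
  shows "-1 \<le> s" "s \<le> n" "0 \<le> c" "c \<le> t * (n - s)" "c \<le> t * (n + 1)" "s = -1 \<Longrightarrow> c = t * (n + 1)"
proof -
  show "-1 \<le> s" "s \<le> n" "0 \<le> c" "c \<le> t * (n - s)" "s = -1 \<Longrightarrow> c = t * (n + 1)"
    using assms by (auto simp: polygon_points_def)
  then show "c \<le> t * (n + 1)"
    using mult_left_mono[of "n - s" "n + 1" t] assms(2) by linarith
qed

lemma polygon_pointsI:
  "0 \<le> s \<Longrightarrow> s \<le> n \<Longrightarrow> 0 \<le> c \<Longrightarrow> c \<le> t * (n - s) \<Longrightarrow> (s, c) \<in> polygon_points t n"
  by (simp add: polygon_points_def)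

text \<open>If the rows are at least two apart, both points can move one row towards each other. The
  values then approach by \<open>2 * M\<close>, more than the changes in \<open>c\<close> can
  offset.\<close>

lemma minimal_pair_rows:
  assumes "t \<ge> 0" "n \<ge> 0" and p: "(s1, c1) \<in> polygon_points t n" "(s2, c2) \<in> polygon_points t n"
    and min: "minimal_pair t n (s1, c1) (s2, c2)"
  shows "s2 \<le> s1 + 1"
proof (rule ccontr)
  assume "\<not> s2 \<le> s1 + 1"
  then have s: "s1 + 2 \<le> s2" by simp
  note p1 = polygon_pointsD[OF p(1) assms(1,2)] and p2 = polygon_pointsD[OF p(2) assms(1,2)]
  \<comment> \<open>Row \<open>s1 + 1\<close> receives as much of \<open>c1 + c2\<close> as fits and
    row \<open>s2 - 1\<close> gets the rest; the two rows have enough room in total.\<close>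
  define j where "j = min (c1 + c2) (t * (n - (s1 + 1))) - c1"
  have pos: "0 \<le> t * (n - (s1 + 1))" using assms s p2 by simp
  have tot: "c1 + c2 \<le> t * (n - (s1 + 1)) + t * (n - (s2 - 1))"
    using p1(4) p2(4) by (simp add: algebra_simps)
  have pos': "0 \<le> t * (n - (s2 - 1))" using assms s p2 by simp
  have 1: "(s1 + 1, c1 + j) \<in> polygon_points t n"
    by (rule polygon_pointsI) (use s p1 p2 pos in \<open>auto simp: j_def\<close>)
  have 2: "(s2 - 1, c2 - j) \<in> polygon_points t n"
    by (rule polygon_pointsI) (use s p1 p2 pos' tot in \<open>auto simp: j_def\<close>)
  define M where "M = t * (n + 1) + 1"
  note b1 = polygon_pointsD(3,5)[OF 1 assms(1,2)] and b2 = polygon_pointsD(3,5)[OF 2 assms(1,2)]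
  have "M \<ge> 1" using assms by (simp add: M_def)
  then have "M * (s1 + 2) \<le> M * s2" using s by (intro mult_left_mono) auto
  then have Ms: "M * s1 + 2 * M \<le> M * s2" by (simp add: algebra_simps)
  have "\<not> minimal_pair t n (s1, c1) (s2, c2)"
    by (rule not_minimal_pair[OF 1 2 M_def])
      (use p1 p2 b1 b2 Ms in \<open>simp_all add: distrib_left right_diff_distrib M_def[symmetric]\<close>,
       use p1 p2 b1 b2 Ms M_def in linarith)+
  then show False using min by simp
qed

text \<open>Points of one row at distance 2 or more can step towards each other. The larger
  \<open>c\<close> comes first in the pair because the linear form decreases in
  \<open>c\<close>.\<close>

lemma minimal_pair_same_row:
  assumes "t \<ge> 0" "n \<ge> 0" and p: "(s, c1) \<in> polygon_points t n" "(s, c2) \<in> polygon_points t n"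
    and min: "minimal_pair t n (s, c2) (s, c1)"
  shows "c2 \<le> c1 + 1"
proof (rule ccontr)
  assume "\<not> c2 \<le> c1 + 1"
  then have c: "c1 + 2 \<le> c2" by simp
  note p1 = polygon_pointsD[OF p(1) assms(1,2)] and p2 = polygon_pointsD[OF p(2) assms(1,2)]
  have "s \<ge> 0" using p1 p2 c by (cases "s = -1") auto
  then have 1: "(s + 0, c2 + -1) \<in> polygon_points t n" "(s - 0, c1 - -1) \<in> polygon_points t n"
    using p1 p2 c by (auto intro!: polygon_pointsI)
  have "\<not> minimal_pair t n (s, c2) (s, c1)"
    by (rule not_minimal_pair[OF 1 refl]) (use c in simp_all)
  then show False using min by simp
qed

text \<open>Otherwise the lower point can lose 1 in \<open>c\<close> and the upper one gain 1, which
  brings their values closer. The hypothesis \<open>s \<ge> 0\<close> excludes the apex, which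
  cannot move within its row.\<close>

lemma minimal_pair_adjacent_rows:
  assumes "t \<ge> 0" "n \<ge> 0" and p: "(s, c1) \<in> polygon_points t n" "(s + 1, c2) \<in> polygon_points t n"
    and "s \<ge> 0" and min: "minimal_pair t n (s, c1) (s + 1, c2)"
  shows "c1 = 0 \<or> c2 = t * (n - (s + 1))"
proof (rule ccontr)
  note p1 = polygon_pointsD[OF p(1) assms(1,2)] and p2 = polygon_pointsD[OF p(2) assms(1,2)]
  assume "\<not> ?thesis"
  then have c: "c1 > 0" "c2 < t * (n - (s + 1))" using p1 p2 by auto
  then have 1: "(s + 0, c1 + -1) \<in> polygon_points t n" "(s + 1 - 0, c2 - -1) \<in> polygon_points t n"
    using p1 p2 \<open>s \<ge> 0\<close> by (auto intro!: polygon_pointsI)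
  define M where "M = t * (n + 1) + 1"
  have "t * (n - (s + 1)) < M"
    using mult_left_mono[of "n - (s + 1)" "n + 1" t] assms(1,5) unfolding M_def by linarith
  then have "c2 + 2 \<le> M" using c by linarith
  then have "\<not> minimal_pair t n (s, c1) (s + 1, c2)"
    by (intro not_minimal_pair[OF 1 M_def]) (use c p1 in \<open>simp_all add: algebra_simps\<close>)
  then show False using min by simp
qed

lemma weighted_sum_mono:
  fixes f g :: "'v \<Rightarrow> int"
  assumes "\<And>i. i \<in> V \<Longrightarrow> u i > (0::nat) \<Longrightarrow> f i \<le> g i"
  shows "(\<Sum>i\<in>V. int (u i) * f i) \<le> (\<Sum>i\<in>V. int (u i) * g i)"
  by (rule sum_mono) (metis assms bot_nat_0.not_eq_extremum mult_left_mono mult_zero_left of_nat_0 of_nat_0_le_iff order_refl)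

lemma weighted_sum_strict_mono:
  fixes f g :: "'v \<Rightarrow> int"
  assumes "finite V" "\<And>i. i \<in> V \<Longrightarrow> u i > (0::nat) \<Longrightarrow> f i \<le> g i"
    and "j \<in> V" "u j > 0" "f j < g j"
  shows "(\<Sum>i\<in>V. int (u i) * f i) < (\<Sum>i\<in>V. int (u i) * g i)"
proof (rule sum_strict_mono_ex1)
  show "\<forall>i\<in>V. int (u i) * f i \<le> int (u i) * g i"
    using assms(2) by (metis bot_nat_0.not_eq_extremum mult_left_mono mult_zero_left of_nat_0 of_nat_0_le_iff order_refl)
qed (use assms in \<open>auto intro!: bexI[of _ j]\<close>)

text \<open>On the support \<open>h\<close> takes its minimum and at most the next integer besides.
  The average thus lies in the half-open unit interval starting at the minimum, whose value is the
  floor of the average.\<close>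

lemma balanced_minimum:
  fixes h :: "'v \<Rightarrow> int"
  assumes V: "finite V" and pos: "\<exists>i\<in>V. u i > (0::nat)"
    and balanced: "\<And>i j. \<lbrakk>i \<in> V; j \<in> V; u i > 0; u j > 0\<rbrakk> \<Longrightarrow> h j \<le> h i + 1"
  obtains i where "i \<in> V" "u i > 0" "\<And>j. j \<in> V \<Longrightarrow> u j > 0 \<Longrightarrow> h i \<le> h j"
    "h i = (\<Sum>j\<in>V. int (u j) * h j) div (\<Sum>j\<in>V. int (u j))"
proof -
  let ?S = "{i \<in> V. u i > 0}"
  obtain i where i: "i \<in> ?S" "\<And>j. j \<in> ?S \<Longrightarrow> h i \<le> h j"
  proof -
    have "finite ?S" "?S \<noteq> {}" using V pos by auto
    from ex_is_arg_min_if_finite[OF this, of h] show ?thesis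
      using that unfolding is_arg_min_linorder by blast
  qed
  let ?N = "\<Sum>j\<in>V. int (u j)"
  have "(\<Sum>j\<in>V. int (u j) * h i) \<le> (\<Sum>j\<in>V. int (u j) * h j)"
    using i by (intro weighted_sum_mono) auto
  moreover have "(\<Sum>j\<in>V. int (u j) * h j) < (\<Sum>j\<in>V. int (u j) * (h i + 1))"
    using i by (intro weighted_sum_strict_mono[OF V, where j = i] balanced) auto
  ultimately have "h i * ?N \<le> (\<Sum>j\<in>V. int (u j) * h j)"
    "(\<Sum>j\<in>V. int (u j) * h j) < (h i + 1) * ?N"
    by (simp_all add: sum_distrib_left algebra_simps sum.distrib)
  then have "(\<Sum>j\<in>V. int (u j) * h j) div ?N = h i"
    by (intro int_div_pos_eq[where r = "(\<Sum>j\<in>V. int (u j) * h j) - ?N * h i"])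
      (simp_all add: algebra_simps)
  then show ?thesis using i that by auto
qed

text \<open>The families are given by their multiplicities \<open>u\<close> and \<open>v\<close>.
  Each case exhibits a point determined by the common size and sums alone, so that it occurs in
  both.\<close>

lemma minimal_families_meet:
  fixes u v :: "'v \<Rightarrow> nat" and s c :: "'v \<Rightarrow> int"
  assumes V: "finite V" and tn: "t \<ge> 0" "n \<ge> 0"
    and inj: "inj_on (\<lambda>i. (s i, c i)) V"
    and pts: "\<And>i. i \<in> V \<Longrightarrow> (s i, c i) \<in> polygon_points t n"
    and pos: "\<exists>i\<in>V. u i > 0" "\<exists>i\<in>V. v i > 0"
    and sums: "(\<Sum>i\<in>V. int (u i)) = (\<Sum>i\<in>V. int (v i))"
      "(\<Sum>i\<in>V. int (u i) * s i) = (\<Sum>i\<in>V. int (v i) * s i)"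
      "(\<Sum>i\<in>V. int (u i) * c i) = (\<Sum>i\<in>V. int (v i) * c i)"
    and min: "\<And>w i j. \<lbrakk>w \<in> {u, v}; i \<in> V; j \<in> V; w i > 0; w j > 0; i \<noteq> j\<rbrakk>
      \<Longrightarrow> minimal_pair t n (s i, c i) (s j, c j)"
  shows "\<exists>i\<in>V. u i > 0 \<and> v i > 0"
proof -
  have meet: ?thesis
    if xy: "\<And>w. w \<in> {u, v} \<Longrightarrow> \<exists>i\<in>V. w i > 0 \<and> s i = x \<and> c i = y" for x y
  proof -
    obtain i j where "i \<in> V" "j \<in> V" "u i > 0" "v j > 0" "(s i, c i) = (s j, c j)"
      using xy[of u] xy[of v] by force
    then show ?thesis using inj by (auto dest: inj_onD)
  qed
  define N where "N = (\<Sum>i\<in>V. int (u i))"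
  define S where "S = (\<Sum>i\<in>V. int (u i) * s i)"
  define C where "C = (\<Sum>i\<in>V. int (u i) * c i)"
  define a where "a = S div N"
  have w_pos: "\<exists>i\<in>V. w i > 0" and w_N: "(\<Sum>i\<in>V. int (w i)) = N"
    and w_S: "(\<Sum>i\<in>V. int (w i) * s i) = S" and w_C: "(\<Sum>i\<in>V. int (w i) * c i) = C"
    if "w \<in> {u, v}" for w
    using that pos sums by (auto simp: N_def S_def C_def)
  have rows: "s j \<le> s i + 1" if "w \<in> {u, v}" "i \<in> V" "j \<in> V" "w i > 0" "w j > 0" for w i j
    using minimal_pair_rows[OF tn pts pts min[OF that]] that by (cases "i = j") auto
  have cols: "c j \<le> c i + 1"
    if "w \<in> {u, v}" "i \<in> V" "j \<in> V" "w i > 0" "w j > 0" "s i = s j" for w i j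
  proof (cases "i = j")
    case False
    then show ?thesis
      using that pts[of i] pts[of j] min[of w j i]
        minimal_pair_same_row[OF tn, of "s j" "c i" "c j"] by simp
  qed simp
  have least_row: "\<exists>i\<in>V. w i > 0 \<and> s i = a"
    and two_rows: "\<And>i. i \<in> V \<Longrightarrow> w i > 0 \<Longrightarrow> s i = a \<or> s i = a + 1"
    if w: "w \<in> {u, v}" for w
  proof -
    obtain i where i: "i \<in> V" "w i > 0" "\<And>j. j \<in> V \<Longrightarrow> w j > 0 \<Longrightarrow> s i \<le> s j" "s i = a"
      using balanced_minimum[OF V w_pos[OF w], where h = s, unfolded w_N[OF w] w_S[OF w], folded a_def]
        rows[OF w] by metis
    then show "\<exists>i\<in>V. w i > 0 \<and> s i = a" by auto
    show "s j = a \<or> s j = a + 1" if "j \<in> V" "w j > 0" for j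
      using rows[OF w i(1) that(1) i(2) that(2)] i(3)[OF that] i(4) by auto
  qed
  have "a \<ge> -1"
    using least_row[of u] polygon_pointsD(1)[OF pts tn] by auto
  define top where "top = t * (n - (a + 1))"
  \<comment> \<open>\<open>R\<close> counts, with multiplicity, the points in row
    \<open>a + 1\<close>; all others lie in row \<open>a\<close>.\<close>
  define R where "R = S - N * a"
  have w_R: "(\<Sum>i\<in>V. int (w i) * (s i - a)) = R" if "w \<in> {u, v}" for w
    using w_N[OF that] w_S[OF that]
    by (simp add: R_def right_diff_distrib sum_subtractf flip: sum_distrib_right)
  show ?thesis
  proof (cases "a = -1")
    \<comment> \<open>Row -1 is occupied in both families and contains only the apex.\<close>
    case True
    show ?thesis
    proof (rule meet[of a "t * (n + 1)"])
      show "\<exists>i\<in>V. w i > 0 \<and> s i = a \<and> c i = t * (n + 1)" if "w \<in> {u, v}" for w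
        using least_row[OF that] polygon_pointsD(6)[OF pts tn] True by auto
    qed
  next
    case False
    then have "a \<ge> 0" using \<open>a \<ge> -1\<close> by simp
    have dichotomy: "c i = 0 \<or> c j = top"
      if "w \<in> {u, v}" "i \<in> V" "j \<in> V" "w i > 0" "w j > 0" "s i = a" "s j = a + 1" for w i j
      using minimal_pair_adjacent_rows[OF tn, of a "c i" "c j"] pts[of i] pts[of j] min[OF that(1-5)]
        \<open>a \<ge> 0\<close> that(2,3,6,7) unfolding top_def by (cases "i = j") auto
    have bounds: "0 \<le> c i" "s i = a + 1 \<Longrightarrow> c i \<le> top" if "i \<in> V" for i
      using polygon_pointsD(3,4)[OF pts tn, OF that] by (auto simp: top_def)
    have R_top: "(\<Sum>i\<in>V. int (w i) * ((s i - a) * top)) = R * top" if "w \<in> {u, v}" for w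
      unfolding w_R[OF that, symmetric] by (simp add: sum_distrib_right mult.assoc)
    \<comment> \<open>\<open>R * top\<close> is the total of \<open>c\<close> when all lower points
      have \<open>c = 0\<close> and all upper ones \<open>c = top\<close>. Comparing
      \<open>C\<close> with it tells which alternative of \<open>dichotomy\<close> yields the shared
      point.\<close>
    consider "\<forall>w\<in>{u, v}. \<forall>i\<in>V. w i > 0 \<longrightarrow> s i = a" | "C < R * top"
      | "R > 0" "C \<ge> R * top"
    proof (cases "R > 0")
      case False
      have "s i = a" if w: "w \<in> {u, v}" "i \<in> V" "w i > 0" for w i
      proof (rule ccontr)
        assume "s i \<noteq> a"
        then have "(\<Sum>j\<in>V. int (w j) * 0) < (\<Sum>j\<in>V. int (w j) * (s j - a))"
          using two_rows[OF w(1)] w by (intro weighted_sum_strict_mono[OF V, where j = i]) force+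
        then show False using False w_R[OF w(1)] by simp
      qed
      then show ?thesis using that(1) by blast
    qed (use that(2,3) in linarith)
    then show ?thesis
    proof cases
      case 1
      show ?thesis
      proof (rule meet[of a "C div N"])
        fix w assume w: "w \<in> {u, v}"
        have bal: "c j \<le> c i + 1" if "i \<in> V" "j \<in> V" "w i > 0" "w j > 0" for i j
          using cols[OF w that] 1 w that by auto
        obtain i where "i \<in> V" "w i > 0" "c i = C div N"
          using balanced_minimum[OF V w_pos[OF w], where h = c, unfolded w_N[OF w] w_C[OF w]]
            bal by metis
        then show "\<exists>i\<in>V. w i > 0 \<and> s i = a \<and> c i = C div N"
          using 1 w by blast
      qed
    next
      case 2
      show ?thesis
      proof (rule meet[of a 0])
        fix w assume w: "w \<in> {u, v}"
        \<comment> \<open>With all upper points at \<open>top\<close> the total would reach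
          \<open>R * top\<close>. An upper point below \<open>top\<close> forces every lower point
          to \<open>c = 0\<close>.\<close>
        have "\<exists>j\<in>V. w j > 0 \<and> s j = a + 1 \<and> c j \<noteq> top"
        proof (rule ccontr)
          assume *: "\<not> ?thesis"
          have "(\<Sum>i\<in>V. int (w i) * ((s i - a) * top)) \<le> (\<Sum>i\<in>V. int (w i) * c i)"
          proof (rule weighted_sum_mono)
            fix i assume "i \<in> V" "w i > 0"
            then show "(s i - a) * top \<le> c i"
              using two_rows[OF w, of i] bounds[of i] * by auto
          qed
          then show False using 2 R_top[OF w] w_C[OF w] by simp
        qed
        then show "\<exists>i\<in>V. w i > 0 \<and> s i = a \<and> c i = 0"
          using least_row[OF w] dichotomy[OF w] by blast
      qed
    next
      case 3
      show ?thesis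
      proof (rule meet[of "a + 1" top])
        fix w assume w: "w \<in> {u, v}"
        have "\<exists>j\<in>V. w j > 0 \<and> s j = a + 1"
        proof (rule ccontr)
          assume "\<not> ?thesis"
          then have "(\<Sum>i\<in>V. int (w i) * (s i - a)) \<le> (\<Sum>i\<in>V. int (w i) * 0)"
            using two_rows[OF w] by (intro weighted_sum_mono) force
          then show False using 3 w_R[OF w] by simp
        qed
        then obtain j where j: "j \<in> V" "w j > 0" "s j = a + 1" by auto
        \<comment> \<open>Otherwise all lower points have \<open>c = 0\<close>, and the total falls
          below \<open>R * top\<close>.\<close>
        have "c j = top"
        proof (rule ccontr)
          assume "c j \<noteq> top"
          then have zero: "c i = 0" if "i \<in> V" "w i > 0" "s i = a" for i
            using dichotomy[OF w _ j(1) _ j(2) _ j(3)] that by blast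
          have "(\<Sum>i\<in>V. int (w i) * c i) < (\<Sum>i\<in>V. int (w i) * ((s i - a) * top))"
          proof (rule weighted_sum_strict_mono[OF V, where j = j])
            fix i assume "i \<in> V" "w i > 0"
            then show "c i \<le> (s i - a) * top"
              using two_rows[OF w, of i] bounds[of i] zero[of i] by auto
          qed (use j bounds[of j] \<open>c j \<noteq> top\<close> in auto)
          then show False using 3 R_top[OF w] w_C[OF w] by simp
        qed
        then show "\<exists>i\<in>V. w i > 0 \<and> s i = a + 1 \<and> c i = top" using j by blast
      qed
    qed
  qed
qed

subsection \<open>The invariant monomials\<close>

text \<open>The library enumerates the type \<open>3\<close> as 1, 2, 3, while the variables are
  indexed by 0, 1, 2.\<close>

lemma three_eq_zero: "(3 :: 3) = 0"
  by simp

lemma sum_UNIV_3: "(\<Sum>i\<in>UNIV. f i) = f (0::3) + f 1 + f 2"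
  by (simp add: sum_3 three_eq_zero ac_simps)

lemma prod_UNIV_3: "(\<Prod>i\<in>UNIV. f i) = f (0::3) * f 1 * f 2"
  unfolding UNIV_3 three_eq_zero by (simp add: mult.commute mult.left_commute)

lemma forall_indices_3: "(\<forall>i::3. P i) \<longleftrightarrow> P 0 \<and> P 1 \<and> P 2"
  unfolding forall_3 three_eq_zero by auto

text \<open>A diagonal matrix scales each variable, so every monomial is an eigenvector; the product
  of powers is its eigenvalue.\<close>

lemma mat_act_diag3:
  "mat_act (diag3 g0 g1 g2) (pmonom a) = (pmonom a :: (3, 'k::field) mpol) \<longleftrightarrow>
    g0 ^ Poly_Mapping.lookup a 0 * g1 ^ Poly_Mapping.lookup a 1 * g2 ^ Poly_Mapping.lookup a 2 = 1"
proof -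
  define g where "g i = diag3 g0 g1 g2 $ i $ i" for i
  have g: "g 0 = g0" "g 1 = g1" "g 2 = g2"
    by (simp_all add: g_def diag3_def)
  have "(\<Sum>j\<in>UNIV. pconst (diag3 g0 g1 g2 $ i $ j) * (pvar j :: (3, 'k) mpol)) =
      (\<Sum>j\<in>UNIV. if j = i then pconst (g i) * pvar i else 0)" for i
    by (rule sum.cong) (auto simp: diag3_def g_def pconst_def)
  then have "(\<Sum>j\<in>UNIV. pconst (diag3 g0 g1 g2 $ i $ j) * (pvar j :: (3, 'k) mpol)) =
      pconst (g i) * pvar i" for i
    by simp
  then have "mat_act (diag3 g0 g1 g2) (pmonom a) =
      (\<Prod>i\<in>Poly_Mapping.keys a. (pconst (g i) * pvar i :: (3, 'k) mpol) ^ Poly_Mapping.lookup a i)"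
    by (simp add: mat_act_def psubst_pmonom)
  also have "\<dots> = pconst (\<Prod>i\<in>Poly_Mapping.keys a. g i ^ Poly_Mapping.lookup a i) * psubst pvar (pmonom a)"
    by (simp add: power_mult_distrib prod.distrib pconst_power pconst_prod psubst_pmonom)
  also have "(\<Prod>i\<in>Poly_Mapping.keys a. g i ^ Poly_Mapping.lookup a i) =
      (\<Prod>i\<in>UNIV. g i ^ Poly_Mapping.lookup a i)"
    by (rule prod.mono_neutral_left) (auto simp: in_keys_iff)
  finally have "mat_act (diag3 g0 g1 g2) (pmonom a) =
      Poly_Mapping.single a (\<Prod>i\<in>UNIV. g i ^ Poly_Mapping.lookup a i)"
    by (simp only: psubst_pvar pconst_mult_pmonom)
  moreover have "Poly_Mapping.single a x = pmonom a \<longleftrightarrow> x = (1 :: 'k)" for x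
    unfolding pmonom_def using inj_single[of a] by (rule inj_eq)
  ultimately show ?thesis
    by (simp add: prod_UNIV_3 g)
qed

lemma diag3_mult: "diag3 a b c ** diag3 a' b' c' = (diag3 (a * a') (b * b') (c * c') :: 'k::field ^ 3 ^ 3)"
  by (simp add: vec_eq_iff matrix_matrix_mult_def sum_UNIV_3 diag3_def forall_indices_3)

lemma diag3_1: "diag3 1 1 1 = (mat 1 :: 'k::field ^ 3 ^ 3)"
  by (simp add: vec_eq_iff mat_def diag3_def)

lemma GL_inverse:
  assumes "A ** B = mat 1" "B ** A = mat 1"
  shows "inv\<^bsub>GL\<^esub> A = B"
proof -
  have unique: "C = B" if "A ** C = mat 1" for C
  proof -
    have "C = (B ** A) ** C"
      by (simp only: assms(2) matrix_mul_lid)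
    also have "\<dots> = B ** (A ** C)"
      by (rule matrix_mul_assoc[symmetric])
    finally show ?thesis by (simp only: that matrix_mul_rid)
  qed
  have "invertible B"
    unfolding invertible_def using assms by blast
  then have "(THE C. C \<in> carrier GL \<and> A \<otimes>\<^bsub>GL\<^esub> C = \<one>\<^bsub>GL\<^esub> \<and> C \<otimes>\<^bsub>GL\<^esub> A = \<one>\<^bsub>GL\<^esub>) = B"
    by (intro the_equality) (simp_all add: GL_def assms, blast intro: unique)
  then show ?thesis by (simp add: m_inv_def)
qed

text \<open>Here \<open>x\<close> is a power of \<open>e\<close>, possibly with negative exponent.
  What is kept of this is that each relation \<open>e ^ n = 1\<close> passes to \<open>x\<close>, a
  property stable under products and inverses.\<close>

lemma generate_diag3:
  fixes e :: "'k::field"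
  assumes "e \<noteq> 0" "A \<in> generate GL {diag3 1 e (e ^ k)}"
  obtains x where "\<And>n. e ^ n = 1 \<Longrightarrow> x ^ n = 1" "A = diag3 1 x (x ^ k)"
proof -
  have "\<exists>x. (\<forall>n. e ^ n = 1 \<longrightarrow> x ^ n = 1) \<and> A = diag3 1 x (x ^ k)"
    using assms(2)
  proof induction
    case one
    have "\<one>\<^bsub>GL\<^esub> = diag3 1 (1 :: 'k) (1 ^ k)"
      by (simp add: GL_def diag3_1)
    then show ?case by (intro exI[of _ 1]) simp
  next
    case (incl h)
    then show ?case by (intro exI[of _ e]) simp
  next
    case (inv h)
    have "e * inverse e = 1" "e ^ k * inverse e ^ k = 1"
      using assms(1) by (simp_all add: power_inverse)
    then have "inv\<^bsub>GL\<^esub> (diag3 1 e (e ^ k)) = diag3 1 (inverse e) (inverse e ^ k)"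
      by (intro GL_inverse) (simp_all add: diag3_mult diag3_1 mult.commute)
    then show ?case using inv by (intro exI[of _ "inverse e"]) (simp add: power_inverse)
  next
    case (eng h1 h2)
    then obtain x y where x: "\<forall>n. e ^ n = 1 \<longrightarrow> x ^ n = 1" "h1 = diag3 1 x (x ^ k)"
      and y: "\<forall>n. e ^ n = 1 \<longrightarrow> y ^ n = 1" "h2 = diag3 1 y (y ^ k)" by blast
    have "h1 \<otimes>\<^bsub>GL\<^esub> h2 = diag3 1 (x * y) ((x * y) ^ k)"
      unfolding x(2) y(2) by (simp add: GL_def diag3_mult power_mult_distrib)
    moreover have "\<forall>n. e ^ n = 1 \<longrightarrow> (x * y) ^ n = 1"
      using x(1) y(1) by (simp add: power_mult_distrib)
    ultimately show ?case by blast
  qed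
  then show ?thesis using that by blast
qed

lemma primitive_root_power_eq_1_iff:
  assumes "primitive_root_of_unity d e"
  shows "e ^ n = 1 \<longleftrightarrow> d dvd n"
proof -
  have "e ^ n = e ^ (d * (n div d) + n mod d)"
    by (simp only: mult_div_mod_eq)
  also have "\<dots> = e ^ (n mod d)"
    using assms unfolding power_add power_mult by (simp add: primitive_root_of_unity_def)
  finally have "e ^ n = 1 \<longleftrightarrow> e ^ (n mod d) = 1" by simp
  moreover have "n mod d < d" and "\<And>j. 0 < j \<Longrightarrow> j < d \<Longrightarrow> e ^ j \<noteq> 1"
    using assms by (auto simp: primitive_root_of_unity_def)
  ultimately show ?thesis
    by (cases "n mod d = 0") (simp_all add: mod_eq_0_iff_dvd)
qed

text \<open>The generator multiplies a monomial by a power of \<open>e\<close>, which is 1 exactly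
  when \<open>d\<close> divides its exponent; by \<open>generate_diag3\<close> the whole group then
  fixes the monomial.\<close>

lemma invariant_monomials_cyclic:
  fixes e :: "'k::field"
  assumes e: "primitive_root_of_unity d e"
  shows "invariant_monomials (generate GL {diag3 1 e (e ^ k)}) n =
    pmonom ` {a. expo_deg a = n \<and> d dvd Poly_Mapping.lookup a 1 + k * Poly_Mapping.lookup a 2}"
proof -
  have "e \<noteq> 0"
    using e by (auto simp: primitive_root_of_unity_def power_0_left split: if_splits)
  have act: "mat_act (diag3 1 x (x ^ k)) (pmonom a) = (pmonom a :: (3, 'k) mpol) \<longleftrightarrow>
      x ^ (Poly_Mapping.lookup a 1 + k * Poly_Mapping.lookup a 2) = 1" for x a
    by (simp add: mat_act_diag3 power_add power_mult)
  have "(\<forall>A\<in>generate GL {diag3 1 e (e ^ k)}. mat_act A (pmonom a) = (pmonom a :: (3, 'k) mpol)) \<longleftrightarrow>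
      d dvd Poly_Mapping.lookup a 1 + k * Poly_Mapping.lookup a 2" (is "?L \<longleftrightarrow> ?R") for a
  proof
    assume ?L
    then show ?R
      using generate.incl[of "diag3 1 e (e ^ k)" "{diag3 1 e (e ^ k)}" GL] act[of e a]
      by (auto simp: primitive_root_power_eq_1_iff[OF e])
  next
    assume ?R
    then have "e ^ (Poly_Mapping.lookup a 1 + k * Poly_Mapping.lookup a 2) = 1"
      by (simp add: primitive_root_power_eq_1_iff[OF e])
    then show ?L
      using act generate_diag3[OF \<open>e \<noteq> 0\<close>] by metis
  qed
  moreover have "invariant_monomials (generate GL {diag3 1 e (e ^ k)}) n =
      pmonom ` {a. expo_deg a = n \<and>
        (\<forall>A\<in>generate GL {diag3 1 e (e ^ k)}. mat_act A (pmonom a) = (pmonom a :: (3, 'k) mpol))}"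
    unfolding invariant_monomials_def by blast
  ultimately show ?thesis by simp
qed

section \<open>Invariant exponents as lattice points\<close>

lemma expo_subst_eq_weighted_sums:
  assumes V: "finite V" "u \<in> expos_in V" "v \<in> expos_in V" "expo_subst \<alpha> u = expo_subst \<alpha> v"
  shows "(\<Sum>i\<in>V. int (Poly_Mapping.lookup u i) * int (Poly_Mapping.lookup (\<alpha> i) x)) =
    (\<Sum>i\<in>V. int (Poly_Mapping.lookup v i) * int (Poly_Mapping.lookup (\<alpha> i) x))"
proof -
  have "int (Poly_Mapping.lookup (expo_subst \<alpha> u) x) = int (Poly_Mapping.lookup (expo_subst \<alpha> v) x)"
    using V by simp
  then show ?thesis
    unfolding lookup_expo_subst[OF V(1,2)] lookup_expo_subst[OF V(1,3)] by simp
qed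

lemma expo_deg_3:
  "expo_deg (a :: 3 expo) = Poly_Mapping.lookup a 0 + Poly_Mapping.lookup a 1 + Poly_Mapping.lookup a 2"
  by (subst expo_deg_superset[of UNIV]) (simp_all add: in_expos_in sum_UNIV_3)

text \<open>On invariant exponents the division is exact. The shear by \<open>s * t * k\<close> is
  chosen so that the exponent of \<open>x_0\<close> becomes \<open>(k - 1) * c\<close>, which puts
  one side of the triangle on the line \<open>c = 0\<close>.\<close>

definition point_of_expo :: "int \<Rightarrow> int \<Rightarrow> 3 expo \<Rightarrow> int \<times> int" where
  "point_of_expo t k a =
    (let s = (int (Poly_Mapping.lookup a 1) + k * int (Poly_Mapping.lookup a 2)) div (t * k * (k - 1)) - 1
     in (s, int (Poly_Mapping.lookup a 2) - s * t * k))"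

text \<open>These affine formulas give injectivity of the coordinates and later translate between
  sums of points and sums of exponents.\<close>

lemma invariant_expo_coordinates:
  fixes a :: "3 expo" and t k :: nat
  assumes "t \<ge> 1" "k \<ge> 2" and d: "d = t * k * (k - 1)"
    and "expo_deg a = d" "d dvd Poly_Mapping.lookup a 1 + k * Poly_Mapping.lookup a 2"
    and p: "point_of_expo (int t) (int k) a = (s, c)"
  shows "int (Poly_Mapping.lookup a 2) = c + s * int t * int k"
    and "int (Poly_Mapping.lookup a 1) = int d * (s + 1) - int k * (c + s * int t * int k)"
    and "int (Poly_Mapping.lookup a 0) = int d - int d * (s + 1) + (int k - 1) * (c + s * int t * int k)"
proof -
  have D: "int t * int k * (int k - 1) = int d"
    using assms by (simp add: d of_nat_diff)
  have "d > 0" using assms by simp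
  obtain r where r: "Poly_Mapping.lookup a 1 + k * Poly_Mapping.lookup a 2 = d * r"
    using assms by (auto elim: dvdE)
  have ri: "int (Poly_Mapping.lookup a 1) + int k * int (Poly_Mapping.lookup a 2) = int d * int r"
    using arg_cong[OF r, of int] by simp
  then have s: "s = int r - 1" and c: "c = int (Poly_Mapping.lookup a 2) - s * int t * int k"
    using p \<open>d > 0\<close> by (auto simp: point_of_expo_def D Let_def)
  show 2: "int (Poly_Mapping.lookup a 2) = c + s * int t * int k"
    using c by simp
  show 1: "int (Poly_Mapping.lookup a 1) = int d * (s + 1) - int k * (c + s * int t * int k)"
    using ri s unfolding 2[symmetric] by simp
  have "int (Poly_Mapping.lookup a 0) + int (Poly_Mapping.lookup a 1) + int (Poly_Mapping.lookup a 2) = int d"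
    using assms(4) by (simp add: expo_deg_3 flip: of_nat_add)
  then show "int (Poly_Mapping.lookup a 0) = int d - int d * (s + 1) + (int k - 1) * (c + s * int t * int k)"
    unfolding 1 2 by (simp add: algebra_simps)
qed

text \<open>Nonnegativity of the three exponents gives the three sides of the triangle: the
  exponents are \<open>(k - 1) * c\<close>, \<open>k * (t * (k - 1 - s) - c)\<close> and
  \<open>c + s * t * k\<close>.\<close>

lemma bij_betw_point_of_expo:
  fixes t k :: nat
  assumes tk: "t \<ge> 1" "k \<ge> 2" and d: "d = t * k * (k - 1)"
  shows "bij_betw (point_of_expo (int t) (int k))
    {a. expo_deg a = d \<and> d dvd Poly_Mapping.lookup a 1 + k * Poly_Mapping.lookup a 2}
    (polygon_points (int t) (int k - 1))" (is "bij_betw ?f ?A ?P")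
proof (rule bij_betw_imageI)
  have D: "int t * int k * (int k - 1) = int d"
    using assms by (simp add: d of_nat_diff)
  have "d > 0" using assms by simp
  have eqI: "a = b" if "Poly_Mapping.lookup a 0 = Poly_Mapping.lookup b 0"
    "Poly_Mapping.lookup a 1 = Poly_Mapping.lookup b 1" "Poly_Mapping.lookup a 2 = Poly_Mapping.lookup b 2"
    for a b :: "3 expo"
    using that forall_indices_3[of "\<lambda>x. Poly_Mapping.lookup a x = Poly_Mapping.lookup b x"]
    by (auto intro: poly_mapping_eqI)
  show "inj_on ?f ?A"
  proof (rule inj_onI)
    fix a b assume ab: "a \<in> ?A" "b \<in> ?A" "?f a = ?f b"
    obtain s c where sc: "?f a = (s, c)" by fastforce
    then have sc': "?f b = (s, c)" using ab by simp
    show "a = b"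
      using invariant_expo_coordinates[OF tk d _ _ sc] invariant_expo_coordinates[OF tk d _ _ sc'] ab
      by (intro eqI) simp_all
  qed
  show "?f ` ?A = ?P"
  proof
    show "?f ` ?A \<subseteq> ?P"
    proof
      fix p assume "p \<in> ?f ` ?A"
      then obtain a where a: "a \<in> ?A" "p = ?f a" by auto
      obtain s c where sc: "?f a = (s, c)" by fastforce
      note co = invariant_expo_coordinates[OF tk d _ _ sc]
      have s: "int d * (s + 1) = int (Poly_Mapping.lookup a 1) + int k * int (Poly_Mapping.lookup a 2)"
        and a2: "int (Poly_Mapping.lookup a 2) = c + s * int t * int k"
        using co a by simp_all
      have "0 \<le> int d * (s + 1)" unfolding s by simp
      then have "s \<ge> -1" using \<open>d > 0\<close> by (simp add: zero_le_mult_iff)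
      show "p \<in> ?P"
      proof (cases "s = -1")
        \<comment> \<open>The exponents of \<open>x_1\<close> and \<open>x_2\<close> vanish, and the
          pure power of \<open>x_0\<close> goes to the apex.\<close>
        case True
        then have "int (Poly_Mapping.lookup a 1) + int k * int (Poly_Mapping.lookup a 2) = 0"
          using s by simp
        then have "int (Poly_Mapping.lookup a 2) = 0"
          using tk by (auto simp: add_nonneg_eq_0_iff)
        then show ?thesis
          using a2 True a sc by (simp add: polygon_points_def)
      next
        case False
        then have "s \<ge> 0" using \<open>s \<ge> -1\<close> by simp
        have "0 \<le> int d - int d * (s + 1) + (int k - 1) * (c + s * int t * int k)"
          using co(3) a by (metis (mono_tags, lifting) mem_Collect_eq of_nat_0_le_iff)
        also have "\<dots> = (int k - 1) * c"
          unfolding D[symmetric] by (simp add: algebra_simps)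
        finally have "c \<ge> 0" using tk by (simp add: zero_le_mult_iff)
        have "0 \<le> int d * (s + 1) - int k * (c + s * int t * int k)"
          using co(2) a by (metis (mono_tags, lifting) mem_Collect_eq of_nat_0_le_iff)
        also have "\<dots> = int k * (int t * (int k - 1 - s) - c)"
          unfolding D[symmetric] by (simp add: algebra_simps)
        finally have c: "c \<le> int t * (int k - 1 - s)" using tk by (simp add: zero_le_mult_iff)
        then have "0 \<le> int t * (int k - 1 - s)" using \<open>c \<ge> 0\<close> by linarith
        then have "s \<le> int k - 1" using tk by (simp add: zero_le_mult_iff)
        then show ?thesis
          using a sc \<open>s \<ge> 0\<close> \<open>c \<ge> 0\<close> c by (simp add: polygon_pointsI)
      qed
    qed
  next
    show "?P \<subseteq> ?f ` ?A"
    proof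
      fix p assume p: "p \<in> ?P"
      obtain s c where sc: "p = (s, c)" by fastforce
      define a2 where "a2 = c + s * int t * int k"
      define a1 where "a1 = int d * (s + 1) - int k * a2"
      define a0 where "a0 = int d - a1 - a2"
      have a1: "a1 = int k * (int t * (int k - 1 - s) - c)"
        unfolding a1_def a2_def D[symmetric] by (simp add: algebra_simps)
      have a0: "a0 = (int k - 1) * c"
        unfolding a0_def a1_def a2_def D[symmetric] by (simp add: algebra_simps)
      have c: "0 \<le> c" "c \<le> int t * (int k - 1 - s)" "s = -1 \<Longrightarrow> c = int t * int k" "s \<ge> -1"
        using polygon_pointsD[of s c "int t" "int k - 1"] p tk sc by simp_all
      have nonneg: "0 \<le> a0" "0 \<le> a1" "0 \<le> a2"
      proof -
        show "0 \<le> a0" "0 \<le> a1" using c tk unfolding a0 a1 by simp_all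
        show "0 \<le> a2" using c unfolding a2_def by (cases "s = -1") auto
      qed
      define a :: "3 expo" where "a = Poly_Mapping.single 0 (nat a0) +
        Poly_Mapping.single 1 (nat a1) + Poly_Mapping.single 2 (nat a2)"
      have look: "int (Poly_Mapping.lookup a 0) = a0" "int (Poly_Mapping.lookup a 1) = a1"
        "int (Poly_Mapping.lookup a 2) = a2"
        using nonneg by (simp_all add: a_def lookup_add lookup_single)
      have sum: "a1 + int k * a2 = int d * (s + 1)"
        by (simp add: a1_def)
      have "int (expo_deg a) = int d"
        by (simp add: expo_deg_3 look) (simp add: a0_def)
      moreover have "int d dvd int (Poly_Mapping.lookup a 1 + k * Poly_Mapping.lookup a 2)"
        by (simp add: look sum)
      ultimately have "a \<in> ?A"
        by (simp only: of_nat_eq_iff int_dvd_int_iff mem_Collect_eq simp_thms)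
      moreover have "?f a = p"
        using \<open>d > 0\<close> by (simp add: point_of_expo_def look D sum sc Let_def) (simp add: a2_def)
      ultimately show "p \<in> ?f ` ?A" by blast
    qed
  qed
qed

section \<open>From lattice points to the toric ideal\<close>

theorem proposition4p10:
  fixes e :: "'k :: {alg_closed_field, field_char_0}"
    and t k d \<mu> :: nat
    and m :: "nat \<Rightarrow> (3, 'k) mpol"
  assumes "t \<ge> 1" and "k \<ge> 2"
    and "d = t * k * (k - 1)"
    and "primitive_root_of_unity d e"
    and "G = generate GL {diag3 1 e (e ^ k)}"
    and "bij_betw m {1..\<mu>} (invariant_monomials G d)"
  shows "has_quadratic_groebner_basis {1..\<mu>} (toric_ideal {1..\<mu>} m)"
proof -
  define V where "V = {1..\<mu>}"
  define A where "A = {a :: 3 expo. expo_deg a = d \<and>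
    d dvd Poly_Mapping.lookup a 1 + k * Poly_Mapping.lookup a 2}"
  define T n where "T = int t" and "n = int k - 1"
  have "d > 0" and tn: "T \<ge> 0" "n \<ge> 0"
    using assms(1-3) by (simp_all add: T_def n_def)
  have "inj_on (pmonom :: 3 expo \<Rightarrow> (3, 'k) mpol) A"
    by (simp add: inj_on_def)
  then have pm: "bij_betw (pmonom :: 3 expo \<Rightarrow> (3, 'k) mpol) A (pmonom ` A)"
    by (rule inj_on_imp_bij_betw)
  have "bij_betw m V (pmonom ` A)"
    using assms(6) unfolding assms(5) invariant_monomials_cyclic[OF assms(4)] V_def A_def .
  then have "bij_betw (inv_into A pmonom \<circ> m) V A"
    using bij_betw_trans bij_betw_inv_into[OF pm] by blast
  then obtain \<alpha> where \<alpha>_def: "\<alpha> = inv_into A (pmonom :: _ \<Rightarrow> (3, 'k) mpol) \<circ> m"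
    and \<alpha>: "bij_betw \<alpha> V A" by blast
  have m: "m i = pmonom (\<alpha> i)" if "i \<in> V" for i
    using \<open>bij_betw m V (pmonom ` A)\<close> that unfolding \<alpha>_def
    by (auto simp: bij_betw_def intro!: f_inv_into_f[symmetric])
  have \<alpha>A: "expo_deg (\<alpha> i) = d" "d dvd Poly_Mapping.lookup (\<alpha> i) 1 + k * Poly_Mapping.lookup (\<alpha> i) 2"
    if "i \<in> V" for i
    using \<alpha> that by (auto simp: bij_betw_def A_def)
  define \<beta> where "\<beta> = point_of_expo T (int k) \<circ> \<alpha>"
  have \<beta>: "bij_betw \<beta> V (polygon_points T n)"
    unfolding \<beta>_def T_def n_def
    using \<alpha> bij_betw_point_of_expo[OF assms(1-3)] unfolding A_def by (rule bij_betw_trans)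
  define s c where "s i = fst (\<beta> i)" and "c i = snd (\<beta> i)" for i
  have \<beta>_eq: "\<beta> i = (s i, c i)" for i
    by (simp add: s_def c_def)
  have co: "int (Poly_Mapping.lookup (\<alpha> i) 2) = c i + s i * (T * int k)"
    "int (Poly_Mapping.lookup (\<alpha> i) 1) = int d * (s i + 1) - int k * (c i + s i * (T * int k))"
    "int (Poly_Mapping.lookup (\<alpha> i) 0) =
      int d - int d * (s i + 1) + (int k - 1) * (c i + s i * (T * int k))"
    if "i \<in> V" for i
    using invariant_expo_coordinates[OF assms(1-3) \<alpha>A[OF that], of "s i" "c i"] \<beta>_eq[of i]
    by (simp_all add: \<beta>_def T_def mult.assoc)
  \<comment> \<open>Variable weights have to be natural numbers; the point weight is a square, so
    \<open>nat\<close> loses nothing.\<close>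
  define \<omega> where "\<omega> i = nat (point_weight T n (\<beta> i))" for i
  have \<omega>: "int (\<omega> i) = point_weight T n (\<beta> i)" for i
    by (simp add: \<omega>_def point_weight_def)
  have minimal: "minimal_pair T n (s i, c i) (s j, c j)"
    if "pair_minimal V \<alpha> \<omega> w" "i \<in> V" "j \<in> V" "i \<in> Poly_Mapping.keys w" "j \<in> Poly_Mapping.keys w" "i \<noteq> j"
    for w i j
    unfolding minimal_pair_def
  proof (intro ballI impI)
    fix p q assume pq: "p \<in> polygon_points T n" "q \<in> polygon_points T n" "p + q = (s i, c i) + (s j, c j)"
    have "p \<in> \<beta> ` V" "q \<in> \<beta> ` V"
      using \<beta> pq by (simp_all add: bij_betw_def)
    then obtain i' j' where ij: "i' \<in> V" "j' \<in> V" "p = \<beta> i'" "q = \<beta> j'"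
      by blast
    have S: "s i + s j = s i' + s j'" and C: "c i + c j = c i' + c j'"
      using pq(3) ij by (simp_all add: \<beta>_eq)
    \<comment> \<open>Exponents are affine in \<open>(s, c)\<close>, and with two summands on each
      side the constant terms agree as well.\<close>
    have *: "\<alpha> i + \<alpha> j = \<alpha> i' + \<alpha> j'"
    proof (rule poly_mapping_eqI)
      fix x :: 3
      have sj: "s j = s i' + s j' - s i" "c j = c i' + c j' - c i" using S C by simp_all
      have "int (Poly_Mapping.lookup (\<alpha> i) x) + int (Poly_Mapping.lookup (\<alpha> j) x) =
          int (Poly_Mapping.lookup (\<alpha> i') x) + int (Poly_Mapping.lookup (\<alpha> j') x)"
        using forall_indices_3[of "\<lambda>x. int (Poly_Mapping.lookup (\<alpha> i) x) + int (Poly_Mapping.lookup (\<alpha> j) x) =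
          int (Poly_Mapping.lookup (\<alpha> i') x) + int (Poly_Mapping.lookup (\<alpha> j') x)"]
        by (simp add: co that ij sj algebra_simps)
      then show "Poly_Mapping.lookup (\<alpha> i + \<alpha> j) x = Poly_Mapping.lookup (\<alpha> i' + \<alpha> j') x"
        by (simp add: lookup_add flip: of_nat_add)
    qed
    then have "\<omega> i + \<omega> j \<le> \<omega> i' + \<omega> j'"
      using that ij unfolding pair_minimal_def by blast
    then have "int (\<omega> i) + int (\<omega> j) \<le> int (\<omega> i') + int (\<omega> j')"
      by simp
    then show "point_weight T n (s i, c i) + point_weight T n (s j, c j)
        \<le> point_weight T n p + point_weight T n q"
      by (simp add: \<omega> ij \<beta>_eq)
  qed
  have common: "Poly_Mapping.keys u \<inter> Poly_Mapping.keys v \<noteq> {}"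
    if uv: "u \<in> expos_in V" "v \<in> expos_in V" "u \<noteq> 0" "v \<noteq> 0" "expo_subst \<alpha> u = expo_subst \<alpha> v"
      "pair_minimal V \<alpha> \<omega> u" "pair_minimal V \<alpha> \<omega> v" for u v
  proof -
    let ?E = "\<lambda>w f. \<Sum>i\<in>V. int (Poly_Mapping.lookup w i) * f i"
    have E: "?E u (\<lambda>i. int (Poly_Mapping.lookup (\<alpha> i) x)) = ?E v (\<lambda>i. int (Poly_Mapping.lookup (\<alpha> i) x))" for x
      using expo_subst_eq_weighted_sums[OF _ uv(1,2,5)] by (simp add: V_def)
    \<comment> \<open>The total degree yields the number of points, the invariance sum then yields
      the sum of \<open>s\<close>, and entry 2 the sum of \<open>c\<close>; the first two need
      division by \<open>d > 0\<close>.\<close>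
    have N_eq: "?E w (\<lambda>i. int (Poly_Mapping.lookup (\<alpha> i) 0)) + ?E w (\<lambda>i. int (Poly_Mapping.lookup (\<alpha> i) 1)) +
        ?E w (\<lambda>i. int (Poly_Mapping.lookup (\<alpha> i) 2)) = int d * (\<Sum>i\<in>V. int (Poly_Mapping.lookup w i))"
      and S_eq: "?E w (\<lambda>i. int (Poly_Mapping.lookup (\<alpha> i) 1)) + int k * ?E w (\<lambda>i. int (Poly_Mapping.lookup (\<alpha> i) 2)) =
        int d * (?E w s + (\<Sum>i\<in>V. int (Poly_Mapping.lookup w i)))"
      and C_eq: "?E w (\<lambda>i. int (Poly_Mapping.lookup (\<alpha> i) 2)) = ?E w c + ?E w s * (T * int k)" for w
      unfolding sum_distrib_left sum_distrib_right sum.distrib[symmetric]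
      by (auto intro!: sum.cong simp: co algebra_simps)
    have N: "(\<Sum>i\<in>V. int (Poly_Mapping.lookup u i)) = (\<Sum>i\<in>V. int (Poly_Mapping.lookup v i))"
      using N_eq[of u] N_eq[of v] E \<open>d > 0\<close> by simp
    moreover have S: "?E u s = ?E v s"
      using S_eq[of u] S_eq[of v] E N \<open>d > 0\<close> by simp
    moreover have "?E u c = ?E v c"
      using C_eq[of u] C_eq[of v] E S by simp
    moreover have "\<exists>i\<in>V. Poly_Mapping.lookup w i > 0" if "w \<in> expos_in V" "w \<noteq> 0" for w
      using that by (metis gr0I in_expos_in lookup_zero poly_mapping_eqI)
    moreover have "inj_on (\<lambda>i. (s i, c i)) V"
      using \<beta> by (simp add: bij_betw_def flip: \<beta>_eq)
    moreover have "(s i, c i) \<in> polygon_points T n" if "i \<in> V" for i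
      using \<beta> that by (auto simp: bij_betw_def simp flip: \<beta>_eq)
    moreover have "minimal_pair T n (s i, c i) (s j, c j)"
      if "w \<in> {Poly_Mapping.lookup u, Poly_Mapping.lookup v}" "i \<in> V" "j \<in> V" "w i > 0" "w j > 0" "i \<noteq> j"
      for w i j
      using that minimal[OF uv(6), of i j] minimal[OF uv(7), of i j] by (auto simp: in_keys_iff)
    ultimately have "\<exists>i\<in>V. Poly_Mapping.lookup u i > 0 \<and> Poly_Mapping.lookup v i > 0"
      using uv tn by (intro minimal_families_meet[where s = s and c = c and t = T and n = n]) (simp_all add: V_def)
    then show ?thesis by (auto simp: in_keys_iff)
  qed
  have "has_quadratic_groebner_basis V (toric_ideal V m)"
  proof (rule quadratic_groebner_basis_criterion[where \<alpha> = \<alpha> and \<omega> = \<omega> and d = d])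
    show "u = v" if "u \<in> expos_in V" "v \<in> expos_in V" "expo_subst \<alpha> u = expo_subst \<alpha> v"
      "pair_minimal V \<alpha> \<omega> u" "pair_minimal V \<alpha> \<omega> v" for u v
      by (rule pair_minimal_unique[where V = V and \<alpha> = \<alpha> and \<omega> = \<omega> and d = d])
        (fact \<alpha>A(1) \<open>d > 0\<close> common that)+
  qed (use m \<alpha>A \<open>d > 0\<close> in \<open>simp_all add: V_def\<close>)
  then show ?thesis by (simp add: V_def)
qed

end
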